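(* Let $G$ be a planar bipartite graph on $n$ vertices. Then the diameter of $\mathcal{G}(G,5)$ is at most $4n^2$.
   Context: A (proper) $5$-colouring of $G$ is a map $f:V(G)\to\{1,\dots,5\}$ with $f(x)\neq f(y)$ for every edge $xy$. The reconfiguration graph $\mathcal{G}(G,5)$ has as vertices the proper $5$-colourings of $G$, two colourings being adjacent if they differ on exactly one vertex. Its diameter is $+\infty$ if it is disconnected. *)

theory Defs
  imports "HOL-Analysis.Analysis"
begin

text \<open>An undirected graph is given by its vertex set and its set of edges, an edge being the
  two-element set of its ends.\<close>

definition simple_graph :: "'a set \<Rightarrow> 'a set set \<Rightarrow> bool" where
  "simple_graph V E \<longleftrightarrow> finite V \<and> (\<forall>e\<in>E. e \<subseteq> V \<and> card e = 2)"

definition bipartite :: "'a set \<Rightarrow> 'a set set \<Rightarrow> bool" where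
  "bipartite V E \<longleftrightarrow>
     (\<exists>A B. A \<union> B = V \<and> A \<inter> B = {} \<and> (\<forall>e\<in>E. \<exists>a\<in>A. \<exists>b\<in>B. e = {a, b}))"

text \<open>A drawing in the Euclidean plane, represented by the type of complex numbers. Vertices are
  distinct points and an edge is a simple arc joining its ends; an arc meets a vertex only
  at its own ends, and two arcs meet only at common ends.\<close>

definition plane_drawing ::
    "'a set \<Rightarrow> 'a set set \<Rightarrow> ('a \<Rightarrow> complex) \<Rightarrow> ('a set \<Rightarrow> real \<Rightarrow> complex) \<Rightarrow> bool" where
  "plane_drawing V E p \<gamma> \<longleftrightarrow>
     inj_on p V \<and>
     (\<forall>e\<in>E. arc (\<gamma> e) \<and> {pathstart (\<gamma> e), pathfinish (\<gamma> e)} = p ` e \<and>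
            path_image (\<gamma> e) \<inter> p ` V = p ` e) \<and>
     (\<forall>e\<in>E. \<forall>e'\<in>E. e \<noteq> e' \<longrightarrow> path_image (\<gamma> e) \<inter> path_image (\<gamma> e') = p ` (e \<inter> e'))"

definition planar :: "'a set \<Rightarrow> 'a set set \<Rightarrow> bool" where
  "planar V E \<longleftrightarrow> (\<exists>p \<gamma>. plane_drawing V E p \<gamma>)"

text \<open>The distance is the least length of a walk, a walk of length \<open>k\<close> being a \<open>k\<close>-fold composition
  of the adjacency relation. As \<open>Inf {} = \<infinity>\<close> on extended naturals, the distance between
  vertices in different components, and hence the diameter of a disconnected graph, is \<open>\<infinity>\<close>.\<close>

definition graph_dist :: "'a set set \<Rightarrow> 'a \<Rightarrow> 'a \<Rightarrow> enat" where
  "graph_dist E x y = (INF k \<in> {k. (x, y) \<in> {(u, v). {u, v} \<in> E} ^^ k}. enat k)"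

definition graph_diameter :: "'a set \<Rightarrow> 'a set set \<Rightarrow> enat" where
  "graph_diameter V E = (SUP x\<in>V. SUP y\<in>V. graph_dist E x y)"

text \<open>Colourings are extensional functions (constantly \<open>undefined\<close> outside \<open>V\<close>), so that maps
  agreeing on \<open>V\<close> are one and the same colouring.\<close>

definition proper_colourings :: "'a set \<Rightarrow> 'a set set \<Rightarrow> nat \<Rightarrow> ('a \<Rightarrow> nat) set" where
  "proper_colourings V E k =
     {f \<in> V \<rightarrow>\<^sub>E {1..k}. \<forall>x y. {x, y} \<in> E \<longrightarrow> f x \<noteq> f y}"

definition recolouring_edges :: "'a set \<Rightarrow> 'a set set \<Rightarrow> nat \<Rightarrow> ('a \<Rightarrow> nat) set set" where
  "recolouring_edges V E k =
     {{f, g} | f g. f \<in> proper_colourings V E k \<and> g \<in> proper_colourings V E k \<and>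
                    card {x \<in> V. f x \<noteq> g x} = 1}"

lemma simple_graph_recolouring:
  assumes "simple_graph V E"
  shows "simple_graph (proper_colourings V E k) (recolouring_edges V E k)"
proof -
  have "finite (V \<rightarrow>\<^sub>E {1..k})"
    using assms by (intro finite_PiE) (auto simp: simple_graph_def)
  then have "finite (proper_colourings V E k)"
    by (simp add: proper_colourings_def)
  then show ?thesis
    by (auto simp: simple_graph_def recolouring_edges_def card_insert_if)
qed

end

theory Submission
  imports Defs
begin

text \<open>Both colourings are recoloured to the colouring that is constant on either side of the bipartition,
  with at most \<open>2 n\<close> moves per vertex, by induction on \<open>n\<close>. A vertex \<open>v\<close> of degree at most 2 is
  deleted: choosing its colours with one step of foresight, it moves at most once per two moves of
  its neighbours. If a vertex \<open>w\<close> of degree 3 has two neighbours of the same colour, these are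
  identified, which lowers the degree of \<open>w\<close> to 2.

  Otherwise all degrees are at least 3 and the neighbours of every vertex of degree 3 have distinct
  colours. Let \<open>Q0\<close> be a maximum independent set of vertices of degree 3. Since a vertex of degree at
  most 3 can always evade one colour, \<open>Q0\<close> does not obstruct the recolouring of the other vertices.
  If no sequence of at most three moves outside \<open>Q0\<close> produced two equally coloured neighbours of
  some \<open>w \<in> Q0\<close>, then frozen vertices would have so many repeated colours around them that the graph
  would have at least \<open>2 n\<close> edges.

  The bound \<open>|E| < 2 n\<close> is needed for the graphs obtained by deletions and contractions. These are
  drawn with vertices replaced by disjoint non-separating continua. Each arc borders at most
  two faces, each face borders at least four arcs, and the number of faces is bounded
  below by splitting them one arc at a time.\<close>

section \<open>Sides of an arc in the plane\<close>

text \<open>The gain of a factor two at a vertex of degree at most 2 is what keeps the maximum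
  number of moves per vertex from multiplying: if all other vertices move at most \<open>B\<close>
  times, the reinserted vertex follows in at most \<open>B\<close> moves, and one more move gives it
  its final colour. A deletion thus costs 1 of the 2 moves by which the allowance \<open>2 n\<close>
  shrinks. A merger removes two vertices, worth 4, and costs at most 2 preparatory moves per vertex
  and 1 for the vertex of degree 3. Two journeys of \<open>2 n^2\<close> moves to a common target
  give the constant 4.

  Merged vertices lie on the same side, so the graph stays bipartite and the target colours them
  alike. Planarity survives since they are merged through their common neighbour, which is deleted
  as well.

  Fewer than \<open>2 n\<close> edges means that degree minus 4 has negative sum; this excess is
  compared with the number of edges at \<open>Q0\<close>. In place of Euler's formula there are two
  inequalities, proved with continuous logarithms, where integer exponents act as winding
  numbers.\<close>

abbreviation arc_inner :: "(real \<Rightarrow> complex) \<Rightarrow> complex set" where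
  "arc_inner \<gamma> \<equiv> path_image \<gamma> - {pathstart \<gamma>, pathfinish \<gamma>}"

text \<open>Subtracting \<open>n\<close> times a logarithm of \<open>s - x\<close> along the
  parametrised circle leaves a function with values in the multiples of 2 pi i, hence a constant.
  One full turn then forces \<open>n\<close> to vanish: \<open>n\<close> is a winding
  number.\<close>

lemma powi_no_logarithm_on_circle:
  fixes x :: complex and r :: real and n :: int
  assumes "r > 0" and L: "continuous_on (sphere x r) L"
    and exp_L: "\<And>s. s \<in> sphere x r \<Longrightarrow> exp (L s) = (s - x) powi n"
  shows "n = 0"
proof -
  define c where "c t = x + of_real r * exp (\<i> * of_real t)" for t :: real
  define d where "d t = L (c t) - of_int n * (of_real (ln r) + \<i> * of_real t)" for t
  have c: "c t \<in> sphere x r" for t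
    using \<open>r > 0\<close> by (simp add: c_def dist_norm norm_mult)
  have "continuous_on {0..2*pi} c"
    unfolding c_def by (intro continuous_intros)
  then have "continuous_on {0..2*pi} (\<lambda>t. L (c t))"
    by (rule continuous_on_compose2[OF L]) (use c in blast)
  then have cont: "continuous_on {0..2*pi} d"
    unfolding d_def by (intro continuous_intros)
  have exp_d: "exp (d t) = 1" for t
  proof -
    have "c t - x = exp (of_real (ln r) + \<i> * of_real t)"
      using \<open>r > 0\<close> by (simp add: c_def exp_add exp_of_real)
    then have "exp (L (c t)) = exp (of_real (ln r) + \<i> * of_real t) powi n"
      using exp_L[OF c[of t]] by simp
    then show ?thesis
      by (simp add: d_def exp_diff exp_power_int)
  qed
  have "d constant_on {0..2*pi}"
  proof (rule continuous_discrete_range_constant[OF _ cont])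
    fix t assume "t \<in> {0..2*pi}"
    have "2*pi \<le> norm (d s - d t)" if "d s \<noteq> d t" for s
    proof -
      obtain k where "d s = d t + of_int (2 * k) * of_real pi * \<i>"
        using exp_d[of s] exp_d[of t] exp_eq[of "d s" "d t"] by auto
      then have k: "d s - d t = of_int (2 * k) * of_real pi * \<i>" by simp
      then have "k \<noteq> 0" using that by auto
      then have "1 \<le> \<bar>real_of_int k\<bar>" by linarith
      then show ?thesis
        by (simp add: k norm_mult)
    qed
    then show "\<exists>e>0. \<forall>y. y \<in> {0..2*pi} \<and> d y \<noteq> d t \<longrightarrow> e \<le> norm (d y - d t)"
      by (intro exI[of _ "2*pi"]) auto
  qed auto
  then have "d 0 = d (2*pi)"
    unfolding constant_on_def by force
  moreover have "c 0 = c (2*pi)"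
    using exp_two_pi_i' by (simp add: c_def mult.commute)
  ultimately show ?thesis
    by (simp add: d_def algebra_simps)
qed

text \<open>Multiplying a logarithm, extended over the component of \<open>x\<close>, by the other two factors
  replaces the product inside that component. The result is a nonvanishing function on the
  plane that agrees with \<open>(s - x) powi a\<close> on big circles.\<close>
lemma exponent_zero_if_logarithm:
  fixes x y z :: complex and a b c :: int
  assumes "compact K" and bdd: "bounded (connected_component_set (- K) x)"
    and "x \<notin> K" "y \<notin> K" "z \<notin> K"
    and xy: "\<not> connected_component (- K) x y" and xz: "\<not> connected_component (- K) x z"
    and L: "continuous_on K L"
    and exp_L: "\<And>s. s \<in> K \<Longrightarrow> exp (L s) = (s - x) powi a * (s - y) powi b * (s - z) powi c"
  shows "a = 0"
proof -
  define X where "X = connected_component_set (- K) x"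
  have "closed K" using \<open>compact K\<close> by (rule compact_imp_closed)
  then have "open X"
    unfolding X_def by (intro open_connected_component) auto
  have "x \<in> X" using \<open>x \<notin> K\<close> by (simp add: X_def connected_component_refl_eq)
  have "X \<inter> K = {}"
    unfolding X_def using connected_component_subset by blast
  have "closure X \<subseteq> X \<union> K"
  proof
    fix s assume s: "s \<in> closure X"
    show "s \<in> X \<union> K"
    proof (rule ccontr)
      assume "s \<notin> X \<union> K"
      then have "open (connected_component_set (- K) s)" "s \<in> connected_component_set (- K) s"
        using \<open>closed K\<close> by (auto intro: open_connected_component simp: connected_component_refl_eq)
      then obtain s' where "s' \<in> X" "s' \<in> connected_component_set (- K) s"
        using s by (metis closure_iff_nhds_not_empty disjoint_iff inf_commute order_refl)
      then have "connected_component (- K) x s"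
        unfolding X_def by (metis connected_component_sym connected_component_trans mem_Collect_eq)
      then show False using \<open>s \<notin> X \<union> K\<close> by (auto simp: X_def)
    qed
  qed
  then have "closure (X \<union> K) \<subseteq> X \<union> K"
    using closure_closed[OF \<open>closed K\<close>] by simp
  then have closed_XK: "closed (X \<union> K)"
    using closure_subset_eq by blast
  obtain M where M: "continuous_on UNIV M" "\<And>s. s \<in> K \<Longrightarrow> M s = L s"
    using Tietze_unbounded[OF L, of UNIV] \<open>closed K\<close> by auto
  define H where "H s = (if s \<in> X \<union> K then exp (M s) * (s - y) powi (-b) * (s - z) powi (-c)
                         else (s - x) powi a)" for s
  have y: "y \<notin> X \<union> K" and z: "z \<notin> X \<union> K"
    using assms(4,5) xy xz by (auto simp: X_def)
  have H_out: "H s = (s - x) powi a" if "s \<notin> X" for s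
  proof (cases "s \<in> K")
    case True
    then have "s \<noteq> y" "s \<noteq> z" using \<open>y \<notin> K\<close> \<open>z \<notin> K\<close> by auto
    then show ?thesis
      using True M exp_L[OF True] by (simp add: H_def power_int_minus field_simps)
  next
    case False
    then show ?thesis using that by (simp add: H_def)
  qed
  have "continuous_on (X \<union> K \<union> - X) H"
  proof (rule continuous_on_closed_Un)
    have "continuous_on (X \<union> K) (\<lambda>s. exp (M s) * (s - y) powi (-b) * (s - z) powi (-c))"
      using y z by (intro continuous_intros continuous_on_subset[OF M(1)]) auto
    then show "continuous_on (X \<union> K) H"
      by (rule continuous_on_eq) (simp add: H_def)
    have "continuous_on (- X) (\<lambda>s. (s - x) powi a)"
      using \<open>x \<in> X\<close> by (intro continuous_intros) auto
    then show "continuous_on (- X) H"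
      by (rule continuous_on_eq) (simp add: H_out)
  qed (use closed_XK \<open>open X\<close> in auto)
  moreover have "X \<union> K \<union> - X = UNIV" by auto
  ultimately have H_cont: "continuous_on UNIV H" by simp
  have "H s \<noteq> 0" for s
  proof (cases "s \<in> X \<union> K")
    case True
    then have "s \<noteq> y" "s \<noteq> z" using y z by auto
    then show ?thesis using True by (simp add: H_def)
  next
    case False
    then have "s \<noteq> x" using \<open>x \<in> X\<close> by auto
    then show ?thesis using False by (simp add: H_def)
  qed
  then obtain N where N: "continuous_on UNIV N" "\<And>s. H s = exp (N s)"
    using continuous_logarithm_on_contractible[OF H_cont contractible_UNIV] by auto
  obtain r where r: "r > 0" "X \<subseteq> ball x r"
    using bdd unfolding X_def by (metis bounded_subset_ballD)
  show "a = 0"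
  proof (rule powi_no_logarithm_on_circle[OF \<open>r > 0\<close>])
    show "continuous_on (sphere x r) N"
      using N(1) by (rule continuous_on_subset) auto
    show "exp (N s) = (s - x) powi a" if "s \<in> sphere x r" for s
      using that r(2) H_out[of s] N(2)[of s] by fastforce
  qed
qed

text \<open>Borsuk maps centred at points of one complementary component are homotopic on
  \<open>S\<close>, so their quotient has a continuous argument \<open>g\<close>; the modulus
  contributes its real logarithm.\<close>

lemma logarithm_quotient_same_component:
  fixes x y :: complex
  assumes "compact S" and xy: "connected_component (- S) x y"
  obtains g where "continuous_on S g" "\<And>s. s \<in> S \<Longrightarrow> exp (g s) = (s - x) / (s - y)"
proof -
  have xS: "x \<notin> S" "y \<notin> S"
    using xy by (meson ComplD connected_component_in)+
  obtain g where contg: "continuous_on S g"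
    and g: "\<And>s. s \<in> S \<Longrightarrow> exp (\<i> * of_real (g s)) = (s - x) /\<^sub>R cmod (s - x) / ((s - y) /\<^sub>R cmod (s - y))"
    using xy \<open>compact S\<close> xS
    apply (simp add: Borsuk_maps_homotopic_in_connected_component_eq [symmetric])
    apply (subst (asm) homotopic_circlemaps_divide)
    apply (auto simp: inessential_eq_continuous_logarithm_circle)
    done
  define h where "h s = of_real (ln (cmod (s - x)) - ln (cmod (s - y))) + \<i> * of_real (g s)" for s
  have "continuous_on S h"
    unfolding h_def using xS by (intro continuous_intros contg) auto
  moreover have "exp (h s) = (s - x) / (s - y)" if "s \<in> S" for s
  proof -
    have "s \<noteq> x" "s \<noteq> y" using that xS by auto
    then have "exp (h s) = of_real (cmod (s - x) / cmod (s - y)) * exp (\<i> * of_real (g s))"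
      using xS that by (simp add: h_def exp_add exp_diff exp_of_real)
    also have "\<dots> = (s - x) / (s - y)"
      using \<open>s \<noteq> x\<close> \<open>s \<noteq> y\<close> by (simp add: g[OF that] scaleR_conv_of_real field_simps)
    finally show ?thesis .
  qed
  ultimately show thesis using that by blast
qed

lemma arc_logarithm:
  fixes f :: "complex \<Rightarrow> complex"
  assumes "arc \<gamma>" "continuous_on (path_image \<gamma>) f" "\<And>s. s \<in> path_image \<gamma> \<Longrightarrow> f s \<noteq> 0"
  obtains k where "continuous_on (path_image \<gamma>) k" "\<And>s. s \<in> path_image \<gamma> \<Longrightarrow> exp (k s) = f s"
proof -
  obtain \<eta> where "homeomorphism {0..1} (path_image \<gamma>) \<gamma> \<eta>"
    using homeomorphism_arc[OF \<open>arc \<gamma>\<close>] by blast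
  then have "{0..1::real} homeomorphic path_image \<gamma>"
    unfolding homeomorphic_def by blast
  then have "contractible (path_image \<gamma>)"
    using homeomorphic_contractible_eq convex_imp_contractible convex_real_interval(5) by blast
  then show thesis
    using continuous_logarithm_on_contractible[OF assms(2)] assms(3) that by metis
qed

lemma exp_eq_imp_int:
  assumes "exp (a::complex) = exp b"
  obtains m :: int where "a - b = of_int m * (2 * of_real pi * \<i>)"
proof -
  obtain m where "a = b + of_int (2 * m) * of_real pi * \<i>"
    using exp_eq[of a b] assms by auto
  then show thesis using that[of m] by (simp add: algebra_simps)
qed

text \<open>An arc has at most two sides. On \<open>S\<close> and on the arc, the quotients of
  \<open>s - x\<close> and of \<open>s - y\<close> by \<open>s - z\<close> have logarithms; the
  obstruction to gluing these is one integer per quotient. Some nontrivial integer combination has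
  no obstruction, which gives a logarithm on the union for a product with exponents
  \<open>a\<close>, \<open>b\<close>, \<open>- a - b\<close>. Were the three points in distinct
  components, the exponents belonging to bounded components would vanish.\<close>

lemma arc_two_sides:
  fixes S :: "complex set"
  assumes "compact S" and "arc \<gamma>"
    and ends: "pathstart \<gamma> \<in> S" "pathfinish \<gamma> \<in> S" and inner: "arc_inner \<gamma> \<inter> S = {}"
    and xz: "connected_component (- S) x z" and yz: "connected_component (- S) y z"
    and nots: "x \<notin> path_image \<gamma>" "y \<notin> path_image \<gamma>" "z \<notin> path_image \<gamma>"
  shows "connected_component (- (S \<union> path_image \<gamma>)) x y \<or>
         connected_component (- (S \<union> path_image \<gamma>)) x z \<or>
         connected_component (- (S \<union> path_image \<gamma>)) y z"
proof (rule ccontr)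
  let ?P = "path_image \<gamma>" and ?K = "S \<union> path_image \<gamma>"
  let ?C = "connected_component (- ?K)"
  assume "\<not> ?thesis"
  then have sep: "\<not> ?C x y" "\<not> ?C x z" "\<not> ?C y z" by auto
  have nS: "x \<notin> S" "y \<notin> S" "z \<notin> S"
    using xz yz by (meson ComplD connected_component_in)+
  have cP: "compact ?P" using \<open>arc \<gamma>\<close> by (simp add: compact_arc_image)
  have cK: "compact ?K" using \<open>compact S\<close> cP by (rule compact_Un)
  obtain g1 where g1: "continuous_on S g1" "\<And>s. s \<in> S \<Longrightarrow> exp (g1 s) = (s - x) / (s - z)"
    using logarithm_quotient_same_component[OF \<open>compact S\<close> xz] by blast
  obtain g2 where g2: "continuous_on S g2" "\<And>s. s \<in> S \<Longrightarrow> exp (g2 s) = (s - y) / (s - z)"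
    using logarithm_quotient_same_component[OF \<open>compact S\<close> yz] by blast
  have cont: "continuous_on ?P (\<lambda>s. (s - x) / (s - z))" "continuous_on ?P (\<lambda>s. (s - y) / (s - z))"
    using nots by (auto intro!: continuous_intros)
  obtain k1 where k1: "continuous_on ?P k1" "\<And>s. s \<in> ?P \<Longrightarrow> exp (k1 s) = (s - x) / (s - z)"
    by (rule arc_logarithm[OF \<open>arc \<gamma>\<close> cont(1)]) (use nots in auto)
  obtain k2 where k2: "continuous_on ?P k2" "\<And>s. s \<in> ?P \<Longrightarrow> exp (k2 s) = (s - y) / (s - z)"
    by (rule arc_logarithm[OF \<open>arc \<gamma>\<close> cont(2)]) (use nots in auto)
  let ?u = "pathstart \<gamma>" and ?v = "pathfinish \<gamma>" and ?T = "2 * of_real pi * \<i> :: complex"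
  have uv: "?u \<in> ?P" "?v \<in> ?P" by auto
  obtain p1 where p1: "g1 ?u - k1 ?u = of_int p1 * ?T"
    using exp_eq_imp_int[of "g1 ?u" "k1 ?u"] g1(2)[OF ends(1)] k1(2)[OF uv(1)] by metis
  obtain q1 where q1: "g1 ?v - k1 ?v = of_int q1 * ?T"
    using exp_eq_imp_int[of "g1 ?v" "k1 ?v"] g1(2)[OF ends(2)] k1(2)[OF uv(2)] by metis
  obtain p2 where p2: "g2 ?u - k2 ?u = of_int p2 * ?T"
    using exp_eq_imp_int[of "g2 ?u" "k2 ?u"] g2(2)[OF ends(1)] k2(2)[OF uv(1)] by metis
  obtain q2 where q2: "g2 ?v - k2 ?v = of_int q2 * ?T"
    using exp_eq_imp_int[of "g2 ?v" "k2 ?v"] g2(2)[OF ends(2)] k2(2)[OF uv(2)] by metis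
  \<comment> \<open>The differences are the jumps of the two quotients between the ends of the arc;
    one homogeneous linear equation in two unknowns has a nonzero integer solution.\<close>
  have "\<exists>a b :: int. (a \<noteq> 0 \<or> b \<noteq> 0) \<and> a * (q1 - p1) + b * (q2 - p2) = 0"
  proof (cases "q1 - p1 = 0")
    case True
    then show ?thesis by (intro exI[of _ 1] exI[of _ 0]) simp
  next
    case False
    then show ?thesis
      by (intro exI[of _ "q2 - p2"] exI[of _ "p1 - q1"]) (simp add: algebra_simps)
  qed
  then obtain a b :: int where ab: "a \<noteq> 0 \<or> b \<noteq> 0" "a * (q1 - p1) + b * (q2 - p2) = 0"
    by blast
  \<comment> \<open>The shift \<open>w\<close> makes the two formulas agree at the start of the arc;
    at its finish, agreement is the equation for \<open>a\<close> and \<open>b\<close>.\<close>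
  define w where "w = of_int (a * p1 + b * p2) * ?T"
  define L where "L s = (if s \<in> S then of_int a * g1 s + of_int b * g2 s
                         else of_int a * k1 s + of_int b * k2 s + w)" for s
  have agree: "of_int a * g1 s + of_int b * g2 s = of_int a * k1 s + of_int b * k2 s + w"
    if "s \<in> S" "s \<in> ?P" for s
  proof -
    have "s = ?u \<or> s = ?v" using inner that by auto
    then consider (1) "s = ?u" | (2) "s = ?v" by blast
    then show ?thesis
    proof cases
      case 1
      have "g1 ?u = k1 ?u + of_int p1 * ?T" "g2 ?u = k2 ?u + of_int p2 * ?T"
        using p1 p2 by (simp_all add: algebra_simps)
      then show ?thesis unfolding 1 w_def by (simp only: of_int_add of_int_mult ring_distribs) (simp add: mult_ac add_ac)
    next
      case 2
      have "a * p1 + b * p2 = a * q1 + b * q2" using ab(2) by (simp add: algebra_simps)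
      moreover have "g1 ?v = k1 ?v + of_int q1 * ?T" "g2 ?v = k2 ?v + of_int q2 * ?T"
        using q1 q2 by (simp_all add: algebra_simps)
      ultimately show ?thesis unfolding 2 w_def by (simp only: of_int_add of_int_mult ring_distribs) (simp add: mult_ac add_ac)
    qed
  qed
  have "continuous_on ?K L"
  proof (rule continuous_on_closed_Un)
    have "continuous_on S (\<lambda>s. of_int a * g1 s + of_int b * g2 s)"
      by (intro continuous_intros g1 g2)
    then show "continuous_on S L"
      by (rule continuous_on_eq) (simp add: L_def)
    have "continuous_on ?P (\<lambda>s. of_int a * k1 s + of_int b * k2 s + w)"
      by (intro continuous_intros k1 k2)
    then show "continuous_on ?P L"
      by (rule continuous_on_eq) (simp add: L_def agree)
  qed (use cP \<open>compact S\<close> compact_imp_closed in auto)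
  have exp_w: "exp w = 1"
    by (auto simp: w_def exp_eq_1 intro: exI[of _ "a * p1 + b * p2"])
  have quot: "((s - x) / (s - z)) powi a * ((s - y) / (s - z)) powi b =
      (s - x) powi a * (s - y) powi b * (s - z) powi (- a - b)" if "s \<noteq> z" for s
    using that by (simp add: power_int_divide_distrib power_int_diff power_int_minus field_simps)
  have exp_L: "exp (L s) = (s - x) powi a * (s - y) powi b * (s - z) powi (- a - b)" if "s \<in> ?K" for s
  proof -
    have "s \<noteq> z" using that nS nots by auto
    have "exp (L s) = ((s - x) / (s - z)) powi a * ((s - y) / (s - z)) powi b"
    proof (cases "s \<in> S")
      case True
      then show ?thesis by (simp add: L_def exp_add g1(2) g2(2) flip: exp_power_int)
    next
      case False
      then have "s \<in> ?P" using that by blast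
      then show ?thesis using False by (simp add: L_def exp_add k1(2) k2(2) exp_w flip: exp_power_int)
    qed
    then show ?thesis using quot[OF \<open>s \<noteq> z\<close>] by simp
  qed
  \<comment> \<open>There is only one unbounded component, so at least two of the three exponents,
    and with them the third, are 0.\<close>
  have unb: "connected_component_set (- ?K) s = connected_component_set (- ?K) t"
    if "\<not> bounded (connected_component_set (- ?K) s)" "\<not> bounded (connected_component_set (- ?K) t)" for s t
    by (rule cobounded_unique_unbounded_component[OF _ _ that])
       (use compact_imp_bounded[OF cK] in simp_all)
  have neq: "connected_component_set (- ?K) x \<noteq> connected_component_set (- ?K) y"
    "connected_component_set (- ?K) x \<noteq> connected_component_set (- ?K) z"
    "connected_component_set (- ?K) y \<noteq> connected_component_set (- ?K) z"
    using sep nS nots by (auto simp: connected_component_eq_eq)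
  have sep': "\<not> ?C y x" "\<not> ?C z x" "\<not> ?C z y"
    using sep by (meson connected_component_sym)+
  have n: "x \<notin> ?K" "y \<notin> ?K" "z \<notin> ?K" using nS nots by auto
  note Z = exponent_zero_if_logarithm[OF cK _ _ _ _ _ _ \<open>continuous_on ?K L\<close>]
  have x0: "a = 0" if "bounded (connected_component_set (- ?K) x)"
    by (rule Z[where a = a and b = b and c = "- a - b", OF that n sep(1,2)]) (simp add: exp_L)
  have y0: "b = 0" if "bounded (connected_component_set (- ?K) y)"
    by (rule Z[where a = b and b = a and c = "- a - b", OF that n(2,1,3) sep'(1) sep(3)]) (simp add: exp_L mult_ac)
  have z0: "- a - b = 0" if "bounded (connected_component_set (- ?K) z)"
    by (rule Z[where a = "- a - b" and b = a and c = b, OF that n(3,1,2) sep'(2,3)]) (simp add: exp_L mult_ac)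
  have "bounded (connected_component_set (- ?K) x) \<or> bounded (connected_component_set (- ?K) y)"
    "bounded (connected_component_set (- ?K) x) \<or> bounded (connected_component_set (- ?K) z)"
    "bounded (connected_component_set (- ?K) y) \<or> bounded (connected_component_set (- ?K) z)"
    using unb neq by blast+
  then show False
    using x0 y0 z0 ab(1) by auto
qed

text \<open>The map \<open>f\<close> turns once around 0 along the arc and is 1 on the rest of
  \<open>Y\<close>. If \<open>Y\<close> did not separate the plane, \<open>f\<close> would have a
  logarithm on \<open>Y\<close>, constant on \<open>C\<close> and yet changing by 2 pi i between the
  ends of the arc.\<close>

lemma arc_closing_cycle_separates:
  fixes Y :: "complex set"
  assumes "compact Y" "arc \<gamma>" "path_image \<gamma> \<subseteq> Y" "closed (Y - arc_inner \<gamma>)"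
    and C: "connected C" "C \<subseteq> Y - arc_inner \<gamma>" "pathstart \<gamma> \<in> C" "pathfinish \<gamma> \<in> C"
  shows "\<not> connected (- Y)"
proof
  assume "connected (- Y)"
  then have "Borsukian Y" using Borsukian_separation_compact \<open>compact Y\<close> by blast
  let ?P = "path_image \<gamma>"
  obtain \<eta> where \<eta>: "homeomorphism {0..1} ?P \<gamma> \<eta>"
    using homeomorphism_arc[OF \<open>arc \<gamma>\<close>] by blast
  define k where "k s = 2 * of_real pi * \<i> * of_real (\<eta> s)" for s
  define f where "f s = (if s \<in> ?P then exp (k s) else 1)" for s
  have inv: "\<eta> (\<gamma> t) = t" if "t \<in> {0..1}" for t
    using \<eta> that by (meson homeomorphism_apply1)
  have \<eta>_ends: "\<eta> (pathstart \<gamma>) = 0" "\<eta> (pathfinish \<gamma>) = 1"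
    by (simp_all add: inv pathstart_def pathfinish_def)
  have k_cont: "continuous_on ?P k"
    unfolding k_def using homeomorphism_cont2[OF \<eta>] by (intro continuous_intros)
  have f_out: "f s = 1" if "s \<notin> arc_inner \<gamma>" for s
    using that \<eta>_ends exp_two_pi_i by (auto simp: f_def k_def mult_ac)
  have "continuous_on (?P \<union> (Y - arc_inner \<gamma>)) f"
  proof (rule continuous_on_closed_Un)
    have "continuous_on ?P (\<lambda>s. exp (k s))" by (intro continuous_intros k_cont)
    then show "continuous_on ?P f" by (rule continuous_on_eq) (simp add: f_def)
    show "continuous_on (Y - arc_inner \<gamma>) f"
      by (rule continuous_on_eq[of _ "\<lambda>_. 1"]) (auto simp: f_out)
  qed (use assms in \<open>auto simp: closed_arc_image\<close>)
  moreover have "?P \<union> (Y - arc_inner \<gamma>) = Y" using assms(3) by auto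
  ultimately have "continuous_on Y f" by simp
  moreover have "f \<in> Y \<rightarrow> - {0}" by (auto simp: f_def)
  ultimately obtain g where g: "continuous_on Y g" "\<And>s. s \<in> Y \<Longrightarrow> f s = exp (g s)"
    using \<open>Borsukian Y\<close> unfolding Borsukian_continuous_logarithm by blast
  have discrete: "h constant_on A" if A: "connected A" "continuous_on A h" and A1: "\<And>s. s \<in> A \<Longrightarrow> exp (h s) = 1"
    for A and h :: "complex \<Rightarrow> complex"
  proof (rule continuous_discrete_range_constant[OF A])
    fix s assume "s \<in> A"
    have "2*pi \<le> norm (h t - h s)" if t: "t \<in> A" "h t \<noteq> h s" for t
    proof -
      obtain m where m: "h t - h s = of_int m * (2 * of_real pi * \<i>)"
        using exp_eq_imp_int[of "h t" "h s"] A1[OF t(1)] A1[OF \<open>s \<in> A\<close>] by metis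
      then have "m \<noteq> 0" using t(2) by auto
      then have "1 \<le> \<bar>real_of_int m\<bar>" by linarith
      then show ?thesis by (simp add: m norm_mult)
    qed
    then show "\<exists>e>0. \<forall>y. y \<in> A \<and> h y \<noteq> h s \<longrightarrow> e \<le> norm (h y - h s)"
      by (intro exI[of _ "2*pi"]) auto
  qed
  have "g constant_on C"
  proof (rule discrete[OF C(1)])
    show "continuous_on C g" using g(1) C(2) by (rule continuous_on_subset[OF _ subset_trans]) auto
    show "exp (g s) = 1" if "s \<in> C" for s
      using that C(2) g(2)[of s] f_out[of s] by (metis DiffD1 DiffD2 subsetD)
  qed
  then have "g (pathstart \<gamma>) = g (pathfinish \<gamma>)"
    using C(3,4) by (force simp: constant_on_def)
  moreover have "(\<lambda>s. g s - k s) constant_on ?P"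
  proof (rule discrete)
    show "connected ?P" using \<open>arc \<gamma>\<close> by (simp add: connected_arc_image)
    show "continuous_on ?P (\<lambda>s. g s - k s)"
      by (intro continuous_intros k_cont continuous_on_subset[OF g(1)] assms(3))
    show "exp (g s - k s) = 1" if "s \<in> ?P" for s
      using g(2)[of s] that assms(3) by (auto simp: f_def exp_diff)
  qed
  then have "g (pathstart \<gamma>) - k (pathstart \<gamma>) = g (pathfinish \<gamma>) - k (pathfinish \<gamma>)"
    unfolding constant_on_def by (metis pathstart_in_path_image pathfinish_in_path_image)
  ultimately show False by (simp add: k_def \<eta>_ends)
qed

section \<open>How adding an arc changes the number of faces\<close>

lemma arc_attach_nonseparating:
  fixes S :: "complex set"
  assumes "compact S" "connected (- S)" "arc \<gamma>" "connected (path_image \<gamma> \<inter> S)"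
  shows "connected (- (S \<union> path_image \<gamma>))"
  by (rule Janiszewski_connected)
     (use assms connected_arc_complement[of \<gamma>] in \<open>auto simp: closed_arc_image Int_commute\<close>)

text \<open>Separation is assumed for the small set \<open>Y0\<close> and transferred to the larger
  \<open>Y\<close>. Every component left by \<open>Y0\<close> and the arc meets the face
  \<open>F\<close> of \<open>Y\<close> that contains the inner arc, so \<open>F\<close> contains two
  points that \<open>Y0\<close> and the arc separate. They replace the at most one point of
  \<open>P\<close> in \<open>F\<close>.\<close>

lemma split_face:
  fixes Y Y0 :: "complex set"
  assumes "Y0 \<subseteq> Y" "closed Y" "closed Y0" "arc \<gamma>" and disj: "arc_inner \<gamma> \<inter> Y = {}"
    and ends: "pathstart \<gamma> \<in> Y0" "pathfinish \<gamma> \<in> Y0"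
    and conn: "connected (- Y0)" and nconn: "\<not> connected (- (Y0 \<union> path_image \<gamma>))"
    and P: "finite P" "P \<subseteq> - Y" "pairwise (\<lambda>a b. \<not> connected_component (- Y) a b) P"
  obtains P' where "finite P'" "P' \<subseteq> - (Y \<union> path_image \<gamma>)"
    "pairwise (\<lambda>a b. \<not> connected_component (- (Y \<union> path_image \<gamma>)) a b) P'" "card P < card P'"
proof -
  let ?I = "arc_inner \<gamma>" and ?Z = "Y0 \<union> path_image \<gamma>"
  have "connected ?I" "?I \<noteq> {}"
    using \<open>arc \<gamma>\<close> arc_imp_simple_path connected_simple_path_endless nonempty_simple_path_endless by blast+
  then obtain q where "q \<in> ?I" by blast
  define F where "F = connected_component_set (- Y) q"
  have "?I \<subseteq> F"
    unfolding F_def using \<open>q \<in> ?I\<close> \<open>connected ?I\<close> disj by (intro connected_component_maximal) auto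
  have "open F" unfolding F_def using \<open>closed Y\<close> by (simp add: open_Compl open_connected_component)
  have "F \<subseteq> - Y" unfolding F_def by (rule connected_component_subset)
  have "closed ?Z" using \<open>closed Y0\<close> \<open>arc \<gamma>\<close> by (simp add: closed_Un closed_arc_image)
  then have open_cc: "open (connected_component_set (- ?Z) s)" for s
    by (intro open_connected_component open_Compl)
  \<comment> \<open>A component \<open>A\<close> missing \<open>F\<close>, and the union
    \<open>B\<close> of \<open>F\<close> with all other components, would be disjoint open sets
    covering \<open>- Y0\<close>; the inner points of the arc are covered by
    \<open>F\<close>.\<close>
  have meets: "\<exists>s\<in>F. connected_component (- ?Z) a s" if "a \<in> - ?Z" for a
  proof (rule ccontr)
    assume no: "\<not> ?thesis"
    define A where "A = connected_component_set (- ?Z) a"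
    define B where "B = (\<Union>s\<in>- ?Z - A. connected_component_set (- ?Z) s) \<union> F"
    have "open A" "open B" unfolding A_def B_def using open_cc \<open>open F\<close> by auto
    moreover have "A \<inter> B = {}"
    proof -
      have "A \<inter> connected_component_set (- ?Z) s = {}" if "s \<in> - ?Z - A" for s
        using that unfolding A_def
        by (metis DiffD2 connected_component_nonoverlap connected_component_eq_eq mem_Collect_eq DiffD1 Int_commute connected_component_sym)
      then show ?thesis using no by (auto simp: A_def B_def)
    qed
    moreover have "- Y0 \<subseteq> A \<union> B"
    proof
      fix s assume "s \<in> - Y0"
      show "s \<in> A \<union> B"
      proof (cases "s \<in> path_image \<gamma>")
        case True
        then have "s \<in> ?I" using \<open>s \<in> - Y0\<close> ends by auto
        then show ?thesis using \<open>?I \<subseteq> F\<close> by (auto simp: B_def)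
      next
        case False
        then have "s \<in> connected_component_set (- ?Z) s"
          using \<open>s \<in> - Y0\<close> by (auto simp: connected_component_refl_eq)
        then show ?thesis using False \<open>s \<in> - Y0\<close> unfolding B_def by blast
      qed
    qed
    ultimately have "A \<inter> - Y0 = {} \<or> B \<inter> - Y0 = {}"
      using connectedD[OF conn] by blast
    moreover have "a \<in> A \<inter> - Y0" using that by (auto simp: A_def connected_component_refl_eq)
    moreover have "q \<in> B \<inter> - Y0" using \<open>q \<in> ?I\<close> \<open>?I \<subseteq> F\<close> disj \<open>Y0 \<subseteq> Y\<close> by (auto simp: B_def)
    ultimately show False by blast
  qed
  obtain a0 b0 where a0: "a0 \<in> - ?Z" and b0: "b0 \<in> - ?Z" and sep0: "\<not> connected_component (- ?Z) a0 b0"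
    using nconn unfolding connected_iff_connected_component by blast
  obtain a where a: "a \<in> F" "connected_component (- ?Z) a0 a" using meets[OF a0] by blast
  obtain b where b: "b \<in> F" "connected_component (- ?Z) b0 b" using meets[OF b0] by blast
  have ab: "\<not> connected_component (- ?Z) a b"
    using a b sep0 by (meson connected_component_sym connected_component_trans)
  have aZ: "a \<in> - ?Z" "b \<in> - ?Z" using a b by (meson connected_component_in)+
  then have "a \<noteq> b" using ab by (metis connected_component_refl)
  define P' where "P' = insert a (insert b (P - F))"
  have sub: "- (Y \<union> path_image \<gamma>) \<subseteq> - Y" "- (Y \<union> path_image \<gamma>) \<subseteq> - ?Z" using \<open>Y0 \<subseteq> Y\<close> by auto
  have F_conn: "connected_component (- Y) s t" if "s \<in> F" "t \<in> F" for s t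
  proof -
    have "connected_component (- Y) q s" "connected_component (- Y) q t"
      using that by (simp_all add: F_def)
    then show ?thesis using connected_component_trans[OF connected_component_sym] by blast
  qed
  have F_out: "\<not> connected_component (- Y) s t" if "s \<in> F" "t \<notin> F" for s t
    using that connected_component_trans[of "- Y" q s t] by (auto simp: F_def)
  show thesis
  proof
    show "finite P'" using P by (simp add: P'_def)
    show "P' \<subseteq> - (Y \<union> path_image \<gamma>)"
      using a(1) b(1) aZ \<open>F \<subseteq> - Y\<close> P(2) \<open>?I \<subseteq> F\<close> ends \<open>Y0 \<subseteq> Y\<close> unfolding P'_def by auto
    show "pairwise (\<lambda>a b. \<not> connected_component (- (Y \<union> path_image \<gamma>)) a b) P'"
    proof (rule pairwiseI, rule notI)
      fix s t assume st: "s \<in> P'" "t \<in> P'" "s \<noteq> t" and c: "connected_component (- (Y \<union> path_image \<gamma>)) s t"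
      have cY: "connected_component (- Y) s t" and cZ: "connected_component (- ?Z) s t"
        using connected_component_of_subset[OF c] sub by blast+
      have "s \<in> F \<longleftrightarrow> t \<in> F"
        using cY F_out by (meson connected_component_sym)
      moreover have "\<not> (s \<in> P \<and> t \<in> P)" using P(3) st(3) cY by (auto simp: pairwise_def)
      ultimately have "{s, t} = {a, b}" using st a(1) b(1) unfolding P'_def by auto
      then show False using cZ ab by (metis connected_component_sym doubleton_eq_iff)
    qed
    have "card (P \<inter> F) \<le> 1"
      using P(1,3) F_conn by (auto simp: card_le_Suc0_iff_eq pairwise_def)
    moreover have "card P = card (P \<inter> F) + card (P - F)"
      using P(1) by (metis card_Int_Diff)
    moreover have "card P' = 2 + card (P - F)"
      using P(1) \<open>a \<noteq> b\<close> a(1) b(1) by (simp add: P'_def)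
    ultimately show "card P < card P'" by linarith
  qed
qed

text \<open>The analogue of the edge bound for forests. An arc with both ends in one continuum would
  close a cycle and separate the plane. So each arc joins two continua, and fusing them along it
  lowers their number by one.\<close>

lemma nonseparating_arcs_card:
  fixes \<gamma> :: "'e \<Rightarrow> real \<Rightarrow> complex" and \<K> :: "complex set set"
  assumes "finite D" "finite \<K>" "\<K> \<noteq> {}" "disjoint \<K>"
    and "\<And>K. K \<in> \<K> \<Longrightarrow> compact K \<and> connected K \<and> K \<noteq> {}"
    and "\<And>d. d \<in> D \<Longrightarrow> arc (\<gamma> d) \<and> pathstart (\<gamma> d) \<in> \<Union>\<K> \<and> pathfinish (\<gamma> d) \<in> \<Union>\<K> \<and> arc_inner (\<gamma> d) \<inter> \<Union>\<K> = {}"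
    and "\<And>d d'. d \<in> D \<Longrightarrow> d' \<in> D \<Longrightarrow> d \<noteq> d' \<Longrightarrow> arc_inner (\<gamma> d) \<inter> arc_inner (\<gamma> d') = {}"
    and "connected (- (\<Union>\<K> \<union> (\<Union>d\<in>D. path_image (\<gamma> d))))"
  shows "card D < card \<K>"
  using assms
proof (induction D arbitrary: \<K> rule: finite_induct)
  case empty
  then show ?case by (simp add: card_gt_0_iff)
next
  case (insert e D)
  note K = insert.prems(4) and arcs = insert.prems(5) and inner = insert.prems(6)
  let ?P = "path_image (\<gamma> e)"
  let ?Y = "\<Union>\<K> \<union> (\<Union>d\<in>insert e D. path_image (\<gamma> d))"
  obtain K L where KL: "K \<in> \<K>" "pathstart (\<gamma> e) \<in> K" "L \<in> \<K>" "pathfinish (\<gamma> e) \<in> L"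
    using arcs[of e] by auto
  have eP: "arc (\<gamma> e)" "arc_inner (\<gamma> e) \<inter> \<Union>\<K> = {}" using arcs[of e] by auto
  have disj_d: "arc_inner (\<gamma> e) \<inter> path_image (\<gamma> d) = {}" if "d \<in> D" for d
    using arcs[of d] eP(2) inner[of e d] that insert.hyps(2) by blast
  have compact_D: "compact (\<Union>\<K> \<union> (\<Union>d\<in>D. path_image (\<gamma> d)))"
    using insert.prems(1) insert.hyps(1) K arcs
    by (intro compact_Un compact_UN compact_Union) (auto simp: compact_arc_image)
  have Y_minus: "?Y - arc_inner (\<gamma> e) = \<Union>\<K> \<union> (\<Union>d\<in>D. path_image (\<gamma> d))"
    using eP(2) disj_d KL by auto
  have "K \<noteq> L"
  proof
    assume "K = L"
    have "\<not> connected (- ?Y)"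
    proof (rule arc_closing_cycle_separates[OF _ eP(1), where C = K])
      show "compact ?Y" using compact_Un[OF compact_D compact_arc_image[OF eP(1)]] by (simp add: Un_ac)
      show "closed (?Y - arc_inner (\<gamma> e))" unfolding Y_minus using compact_D by (rule compact_imp_closed)
      show "K \<subseteq> ?Y - arc_inner (\<gamma> e)" unfolding Y_minus using KL by auto
    qed (use KL K \<open>K = L\<close> in auto)
    then show False using insert.prems(7) by simp
  qed
  define M where "M = K \<union> ?P \<union> L"
  define \<K>' where "\<K>' = insert M (\<K> - {K, L})"
  have M_disj: "M \<inter> N = {}" if "N \<in> \<K>" "N \<noteq> K" "N \<noteq> L" for N
  proof -
    have "K \<inter> N = {}" "L \<inter> N = {}" using insert.prems(3) that KL by (auto simp: disjoint_def)
    then show ?thesis using eP(2) KL that unfolding M_def by blast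
  qed
  have "K \<noteq> {}" using K KL by blast
  then have "M \<notin> \<K> - {K, L}" using M_disj[of M] unfolding M_def by blast
  then have card: "card \<K> = Suc (card \<K>')"
  proof -
    have "card \<K> = card (insert K (insert L (\<K> - {K, L})))"
      using KL by (intro arg_cong[where f = card]) blast
    then show ?thesis
      using insert.prems(1) \<open>K \<noteq> L\<close> \<open>M \<notin> \<K> - {K, L}\<close> by (simp add: \<K>'_def)
  qed
  have union: "\<Union>\<K>' = \<Union>\<K> \<union> ?P" unfolding \<K>'_def M_def using KL by blast
  have "card D < card \<K>'"
  proof (rule insert.IH)
    show "finite \<K>'" "\<K>' \<noteq> {}" using insert.prems(1) by (simp_all add: \<K>'_def)
    show "disjoint \<K>'"
      using insert.prems(3) M_disj unfolding \<K>'_def disjoint_def by (auto simp: Int_commute)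
    have "connected (K \<union> ?P \<union> L)"
    proof (intro connected_Un)
      show "connected ?P" using eP(1) by (simp add: connected_arc_image)
      show "K \<inter> ?P \<noteq> {}" "(K \<union> ?P) \<inter> L \<noteq> {}" using KL by auto
    qed (use K KL in auto)
    moreover have "compact (K \<union> ?P \<union> L)"
      using K KL eP(1) by (intro compact_Un) (auto simp: compact_arc_image)
    ultimately show "compact N \<and> connected N \<and> N \<noteq> {}" if "N \<in> \<K>'" for N
      using that K \<open>K \<noteq> {}\<close> unfolding \<K>'_def M_def by auto
    show "arc (\<gamma> d) \<and> pathstart (\<gamma> d) \<in> \<Union>\<K>' \<and> pathfinish (\<gamma> d) \<in> \<Union>\<K>' \<and> arc_inner (\<gamma> d) \<inter> \<Union>\<K>' = {}"
      if "d \<in> D" for d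
    proof -
      have "arc_inner (\<gamma> d) \<inter> ?P = {}"
        using inner[of d e] that insert.hyps(2) arcs[of d] KL by blast
      then show ?thesis using arcs[of d] that unfolding union by blast
    qed
    show "arc_inner (\<gamma> d) \<inter> arc_inner (\<gamma> d') = {}" if "d \<in> D" "d' \<in> D" "d \<noteq> d'" for d d'
      using inner that by blast
    show "connected (- (\<Union>\<K>' \<union> (\<Union>d\<in>D. path_image (\<gamma> d))))"
      using insert.prems(7) unfolding union by (simp add: Un_assoc)
  qed
  then show ?case using card insert.hyps by simp
qed

section \<open>Drawings with fat vertices\<close>

text \<open>With continua instead of points as vertices, the contraction of an edge only enlarges a vertex.\<close>
definition blob_drawing ::
    "'a set \<Rightarrow> 'a set set \<Rightarrow> ('a \<Rightarrow> complex set) \<Rightarrow> ('a set \<Rightarrow> real \<Rightarrow> complex) \<Rightarrow> bool" where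
  "blob_drawing V E K \<gamma> \<longleftrightarrow>
     (\<forall>x\<in>V. compact (K x) \<and> connected (K x) \<and> connected (- K x) \<and> K x \<noteq> {}) \<and>
     (\<forall>x\<in>V. \<forall>y\<in>V. x \<noteq> y \<longrightarrow> K x \<inter> K y = {}) \<and>
     (\<forall>e\<in>E. arc (\<gamma> e) \<and> arc_inner (\<gamma> e) \<inter> \<Union>(K ` V) = {} \<and>
        (\<exists>x\<in>V. \<exists>y\<in>V. e = {x, y} \<and> pathstart (\<gamma> e) \<in> K x \<and> pathfinish (\<gamma> e) \<in> K y)) \<and>
     (\<forall>e\<in>E. \<forall>e'\<in>E. e \<noteq> e' \<longrightarrow> arc_inner (\<gamma> e) \<inter> arc_inner (\<gamma> e') = {})"

definition blob_planar :: "'a set \<Rightarrow> 'a set set \<Rightarrow> bool" where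
  "blob_planar V E \<longleftrightarrow> (\<exists>K \<gamma>. blob_drawing V E K \<gamma>)"

lemma blob_drawingD:
  assumes "blob_drawing V E K \<gamma>"
  shows "x \<in> V \<Longrightarrow> compact (K x)" "x \<in> V \<Longrightarrow> connected (K x)" "x \<in> V \<Longrightarrow> connected (- K x)"
    "x \<in> V \<Longrightarrow> K x \<noteq> {}" "x \<in> V \<Longrightarrow> y \<in> V \<Longrightarrow> x \<noteq> y \<Longrightarrow> K x \<inter> K y = {}"
    "e \<in> E \<Longrightarrow> arc (\<gamma> e)" "e \<in> E \<Longrightarrow> arc_inner (\<gamma> e) \<inter> \<Union>(K ` V) = {}"
    "e \<in> E \<Longrightarrow> \<exists>x\<in>V. \<exists>y\<in>V. e = {x, y} \<and> pathstart (\<gamma> e) \<in> K x \<and> pathfinish (\<gamma> e) \<in> K y"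
    "e \<in> E \<Longrightarrow> e' \<in> E \<Longrightarrow> e \<noteq> e' \<Longrightarrow> arc_inner (\<gamma> e) \<inter> arc_inner (\<gamma> e') = {}"
proof -
  note d = assms[unfolded blob_drawing_def]
  note vertex = conjunct1[OF d, THEN bspec] and disj = conjunct1[OF conjunct2[OF d], rule_format]
    and arcs = conjunct1[OF conjunct2[OF conjunct2[OF d]], THEN bspec]
    and inner = conjunct2[OF conjunct2[OF conjunct2[OF d]], rule_format]
  show "compact (K x)" "connected (K x)" "connected (- K x)" "K x \<noteq> {}" if "x \<in> V"
    using vertex[OF that] by auto
  show "K x \<inter> K y = {}" if "x \<in> V" "y \<in> V" "x \<noteq> y" using that by (rule disj)
  show "arc (\<gamma> e)" if "e \<in> E" using arcs[OF that] by (rule conjunct1)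
  show "arc_inner (\<gamma> e) \<inter> \<Union>(K ` V) = {}" if "e \<in> E"
    using arcs[OF that, THEN conjunct2] by (rule conjunct1)
  show "\<exists>x\<in>V. \<exists>y\<in>V. e = {x, y} \<and> pathstart (\<gamma> e) \<in> K x \<and> pathfinish (\<gamma> e) \<in> K y" if "e \<in> E"
    using arcs[OF that, THEN conjunct2] by (rule conjunct2)
  show "arc_inner (\<gamma> e) \<inter> arc_inner (\<gamma> e') = {}" if "e \<in> E" "e' \<in> E" "e \<noteq> e'"
    using that by (rule inner)
qed

lemma blob_drawing_subgraph:
  assumes "blob_drawing V E K \<gamma>" "V' \<subseteq> V" "E' \<subseteq> E" "\<And>e. e \<in> E' \<Longrightarrow> e \<subseteq> V'"
  shows "blob_drawing V' E' K \<gamma>"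
  unfolding blob_drawing_def
proof (intro conjI ballI impI)
  fix e assume "e \<in> E'"
  then have "e \<in> E" "e \<subseteq> V'" using assms(3,4) by auto
  then show "\<exists>x\<in>V'. \<exists>y\<in>V'. e = {x, y} \<and> pathstart (\<gamma> e) \<in> K x \<and> pathfinish (\<gamma> e) \<in> K y"
    using blob_drawingD(8)[OF assms(1)] by (metis insert_subset)
  show "arc_inner (\<gamma> e) \<inter> \<Union>(K ` V') = {}"
    using blob_drawingD(7)[OF assms(1) \<open>e \<in> E\<close>] assms(2) by blast
  show "arc (\<gamma> e)" by (rule blob_drawingD(6)[OF assms(1) \<open>e \<in> E\<close>])
next
  fix e e' assume "e \<in> E'" "e' \<in> E'" "e \<noteq> e'"
  then show "arc_inner (\<gamma> e) \<inter> arc_inner (\<gamma> e') = {}"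
    using assms(3) by (intro blob_drawingD(9)[OF assms(1)]) auto
next
  fix x y assume "x \<in> V'" "y \<in> V'" "x \<noteq> y"
  then show "K x \<inter> K y = {}"
    using assms(2) by (intro blob_drawingD(5)[OF assms(1)]) auto
qed (use blob_drawingD(1-4)[OF assms(1)] assms(2) in auto)

lemma blob_planar_subgraph:
  assumes "blob_planar V E" "V' \<subseteq> V" "E' \<subseteq> E" "\<And>e. e \<in> E' \<Longrightarrow> e \<subseteq> V'"
  shows "blob_planar V' E'"
proof -
  obtain K \<gamma> where "blob_drawing V E K \<gamma>" using assms(1) unfolding blob_planar_def by blast
  then have "blob_drawing V' E' K \<gamma>" using assms(2-) by (rule blob_drawing_subgraph)
  then show ?thesis unfolding blob_planar_def by blast
qed

lemma planar_imp_blob_planar: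
  assumes "simple_graph V E" "planar V E"
  shows "blob_planar V E"
proof -
  obtain p \<gamma> where d: "plane_drawing V E p \<gamma>"
    using assms(2) unfolding planar_def by blast
  have "blob_drawing V E (\<lambda>x. {p x}) \<gamma>"
    unfolding blob_drawing_def
  proof (intro conjI ballI impI)
    fix x y assume "x \<in> V" "y \<in> V" "x \<noteq> y"
    then show "{p x} \<inter> {p y} = {}" using d by (auto simp: plane_drawing_def inj_on_def)
  next
    fix e assume "e \<in> E"
    then have e: "e \<subseteq> V" "card e = 2" using assms(1) by (auto simp: simple_graph_def)
    have g: "arc (\<gamma> e)" "{pathstart (\<gamma> e), pathfinish (\<gamma> e)} = p ` e" "path_image (\<gamma> e) \<inter> p ` V = p ` e"
      using d \<open>e \<in> E\<close> by (auto simp: plane_drawing_def)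
    show "arc (\<gamma> e)" by fact
    show "arc_inner (\<gamma> e) \<inter> \<Union>((\<lambda>x. {p x}) ` V) = {}" using g(2,3) by auto
    obtain a b where ab: "e = {a, b}" using e(2) by (meson card_2_iff)
    then consider "pathstart (\<gamma> e) = p a" "pathfinish (\<gamma> e) = p b" | "pathstart (\<gamma> e) = p b" "pathfinish (\<gamma> e) = p a"
      using g(2) by (auto simp: doubleton_eq_iff)
    then show "\<exists>x\<in>V. \<exists>y\<in>V. e = {x, y} \<and> pathstart (\<gamma> e) \<in> {p x} \<and> pathfinish (\<gamma> e) \<in> {p y}"
      using ab e(1) by cases (auto intro: insert_commute)
  next
    fix e e' assume e: "e \<in> E" "e' \<in> E" "e \<noteq> e'"
    then have "path_image (\<gamma> e) \<inter> path_image (\<gamma> e') = p ` (e \<inter> e')"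
      "{pathstart (\<gamma> e), pathfinish (\<gamma> e)} = p ` e"
      using d by (auto simp: plane_drawing_def)
    then show "arc_inner (\<gamma> e) \<inter> arc_inner (\<gamma> e') = {}" by auto
  qed (auto simp: connected_punctured_universe)
  then show ?thesis unfolding blob_planar_def by blast
qed

text \<open>The edge set after identifying \<open>y\<close> with \<open>x\<close>; a contraction if \<open>x\<close> and \<open>y\<close> are adjacent.\<close>
definition absorb :: "'a \<Rightarrow> 'a \<Rightarrow> 'a set set \<Rightarrow> 'a set set" where
  "absorb x y E = {e \<in> E. y \<notin> e} \<union> {{x, z} | z. {y, z} \<in> E \<and> z \<noteq> x}"

text \<open>The arc meets each of its two blobs in a single point, so Janiszewski's theorem, applied
  twice, keeps the complement of the fused blob connected.\<close>

lemma blob_planar_absorb: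
  assumes "blob_planar V E" and xy: "{x, y} \<in> E" and simple: "\<And>e. e \<in> E \<Longrightarrow> card e = 2"
  shows "blob_planar (V - {y}) (absorb x y E)"
proof -
  obtain K \<gamma> where d: "blob_drawing V E K \<gamma>" using assms(1) unfolding blob_planar_def by blast
  note D = blob_drawingD[OF d]
  have "x \<noteq> y" using simple[OF xy] by auto
  let ?P = "path_image (\<gamma> {x, y})"
  obtain u v where uv: "u \<in> V" "v \<in> V" "{x, y} = {u, v}" "pathstart (\<gamma> {x, y}) \<in> K u" "pathfinish (\<gamma> {x, y}) \<in> K v"
    using D(8)[OF xy] by blast
  then have xV: "x \<in> V" "y \<in> V" by (auto simp: doubleton_eq_iff)
  have P_sub: "?P \<subseteq> arc_inner (\<gamma> {x, y}) \<union> K x \<union> K y"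
    using uv by (auto simp: doubleton_eq_iff)
  have ends: "?P \<inter> K x = {pathstart (\<gamma> {x, y})} \<and> ?P \<inter> K y = {pathfinish (\<gamma> {x, y})} \<or>
      ?P \<inter> K x = {pathfinish (\<gamma> {x, y})} \<and> ?P \<inter> K y = {pathstart (\<gamma> {x, y})}"
  proof -
    have aux: "P \<inter> A = {a} \<and> P \<inter> B = {b}"
      if "P = insert a (insert b I)" "I \<inter> A = {}" "I \<inter> B = {}" "A \<inter> B = {}" "a \<in> A" "b \<in> B"
      for P I A B and a b :: complex
      using that by blast
    have P: "?P = insert (pathstart (\<gamma> {x, y})) (insert (pathfinish (\<gamma> {x, y})) (arc_inner (\<gamma> {x, y})))"
      by auto
    have P': "?P = insert (pathfinish (\<gamma> {x, y})) (insert (pathstart (\<gamma> {x, y})) (arc_inner (\<gamma> {x, y})))"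
      by auto
    have inn: "arc_inner (\<gamma> {x, y}) \<inter> K x = {}" "arc_inner (\<gamma> {x, y}) \<inter> K y = {}"
      using D(7)[OF xy] xV by blast+
    have "u = x \<and> v = y \<or> u = y \<and> v = x" using uv(3) by (auto simp: doubleton_eq_iff)
    then show ?thesis
      using aux[OF P inn D(5)[OF xV \<open>x \<noteq> y\<close>]] aux[OF P' inn D(5)[OF xV \<open>x \<noteq> y\<close>]] uv(4,5) by auto
  qed
  define K' where "K' = K(x := K x \<union> ?P \<union> K y)"
  \<comment> \<open>\<open>g e\<close> is the old edge whose arc draws the new edge
    \<open>e\<close>. If \<open>x\<close> and \<open>y\<close> have a common neighbour, two edges
    become one and the arc at \<open>x\<close> is kept.\<close>
  define g where "g e = (if e \<in> E \<and> y \<notin> e then e else insert y (e - {x}))" for e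
  have arcP: "arc (\<gamma> {x, y})" using D(6) xy .
  have K'_Un: "\<Union>(K' ` (V - {y})) = \<Union>(K ` V) \<union> ?P"
    using xV \<open>x \<noteq> y\<close> by (auto simp: K'_def split: if_splits)
  have new: "g e = {y, z} \<and> e = {x, z} \<and> z \<noteq> y" if "{y, z} \<in> E" "z \<noteq> x" "e = {x, z}" "e \<notin> E \<or> y \<in> e" for e z
    using that \<open>x \<noteq> y\<close> simple[OF that(1)] by (auto simp: g_def)
  have g_cases: "(g e = e \<and> e \<in> E \<and> y \<notin> e) \<or> (\<exists>z. g e = {y, z} \<and> e = {x, z} \<and> {y, z} \<in> E \<and> z \<noteq> x \<and> z \<noteq> y)"
    if "e \<in> absorb x y E" for e
  proof (cases "e \<in> E \<and> y \<notin> e")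
    case True
    then show ?thesis by (simp add: g_def)
  next
    case False
    then obtain z where "e = {x, z}" "{y, z} \<in> E" "z \<noteq> x" using \<open>e \<in> absorb x y E\<close> by (auto simp: absorb_def)
    then show ?thesis using new[of z e] False by blast
  qed
  have gE: "g e \<in> E" "g e \<noteq> {x, y}" if "e \<in> absorb x y E" for e
    using g_cases[OF that] by (auto simp: doubleton_eq_iff)
  have g_inj: "g e \<noteq> g e'" if "e \<in> absorb x y E" "e' \<in> absorb x y E" "e \<noteq> e'" for e e'
    using g_cases[OF that(1)] g_cases[OF that(2)] that(3) by (auto simp: doubleton_eq_iff)
  have "blob_drawing (V - {y}) (absorb x y E) K' (\<lambda>e. \<gamma> (g e))"
    unfolding blob_drawing_def
  proof (intro conjI ballI impI)
    fix w assume w: "w \<in> V - {y}"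
    show "compact (K' w)"
      using w D(1) xV arcP by (auto simp: K'_def compact_arc_image intro!: compact_Un)
    show "K' w \<noteq> {}" using w D(4) by (auto simp: K'_def)
    have "connected (K x \<union> ?P \<union> K y)"
    proof (intro connected_Un)
      show "connected ?P" using arcP by (simp add: connected_arc_image)
      show "K x \<inter> ?P \<noteq> {}" "(K x \<union> ?P) \<inter> K y \<noteq> {}" using ends by auto
    qed (use D(2) xV in auto)
    then show "connected (K' w)" using w D(2) by (auto simp: K'_def)
    have "connected (- (K x \<union> ?P))"
      using ends D(1,3) xV arcP by (intro arc_attach_nonseparating) auto
    moreover have "compact (K x \<union> ?P)"
      using D(1) xV arcP by (simp add: compact_Un compact_arc_image)
    moreover have "(K x \<union> ?P) \<inter> K y = ?P \<inter> K y" using D(5)[OF xV \<open>x \<noteq> y\<close>] by auto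
    then have "connected ((K x \<union> ?P) \<inter> K y)" using ends by auto
    ultimately have "connected (- (K x \<union> ?P \<union> K y))"
      using Janiszewski_connected[OF _ compact_imp_closed[OF D(1)[OF xV(2)]] _ _ D(3)[OF xV(2)]] by blast
    then show "connected (- K' w)" using w D(3) by (auto simp: K'_def)
  next
    fix w w' assume w: "w \<in> V - {y}" "w' \<in> V - {y}" "w \<noteq> w'"
    have N: "(K x \<union> ?P \<union> K y) \<inter> K u = {}" if "u \<in> V" "u \<noteq> x" "u \<noteq> y" for u
    proof -
      have "K x \<inter> K u = {}" "K y \<inter> K u = {}" using D(5) xV that by blast+
      moreover have "arc_inner (\<gamma> {x, y}) \<inter> K u = {}" using D(7)[OF xy] that by blast
      ultimately show ?thesis using P_sub by blast
    qed
    show "K' w \<inter> K' w' = {}"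
    proof (cases "w = x \<or> w' = x")
      case True
      then show ?thesis using N[of w] N[of w'] w unfolding K'_def by (auto simp: Int_commute)
    next
      case False
      then show ?thesis using D(5)[of w w'] w by (simp add: K'_def)
    qed
  next
    fix e assume e: "e \<in> absorb x y E"
    show "arc (\<gamma> (g e))" using D(6) gE(1)[OF e] by blast
    have "arc_inner (\<gamma> (g e)) \<inter> ?P = {}"
      using P_sub D(7)[OF gE(1)[OF e]] D(9)[OF gE(1)[OF e] xy gE(2)[OF e]] xV by blast
    then show "arc_inner (\<gamma> (g e)) \<inter> \<Union>(K' ` (V - {y})) = {}"
      unfolding K'_Un using D(7)[OF gE(1)[OF e]] by blast
    obtain a b where ab: "a \<in> V" "b \<in> V" "g e = {a, b}" "pathstart (\<gamma> (g e)) \<in> K a" "pathfinish (\<gamma> (g e)) \<in> K b"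
      using D(8)[OF gE(1)[OF e]] by blast
    define r where "r c = (if c = y then x else c)" for c
    have r: "r a \<in> V - {y}" "r b \<in> V - {y}" using ab xV \<open>x \<noteq> y\<close> by (auto simp: r_def)
    have e_eq: "e = {r a, r b}"
      using g_cases[OF e] ab(3) unfolding r_def by (auto simp: doubleton_eq_iff)
    have "K c \<subseteq> K' (r c)" for c by (auto simp: K'_def r_def)
    then have "pathstart (\<gamma> (g e)) \<in> K' (r a)" "pathfinish (\<gamma> (g e)) \<in> K' (r b)"
      using ab(4,5) by auto
    then show "\<exists>a\<in>V - {y}. \<exists>b\<in>V - {y}. e = {a, b} \<and> pathstart (\<gamma> (g e)) \<in> K' a \<and> pathfinish (\<gamma> (g e)) \<in> K' b"
      using r e_eq by (intro bexI[of _ "r a"] bexI[of _ "r b"] conjI)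
  next
    fix e e' assume "e \<in> absorb x y E" "e' \<in> absorb x y E" "e \<noteq> e'"
    then show "arc_inner (\<gamma> (g e)) \<inter> arc_inner (\<gamma> (g e')) = {}"
      by (intro D(9) gE(1) g_inj)
  qed
  then show ?thesis unfolding blob_planar_def by blast
qed

section \<open>Counting the faces of a bipartite drawing\<close>

abbreviation skeleton :: "'a set \<Rightarrow> 'a set set \<Rightarrow> ('a \<Rightarrow> complex set) \<Rightarrow> ('a set \<Rightarrow> real \<Rightarrow> complex) \<Rightarrow> complex set" where
  "skeleton V D K \<gamma> \<equiv> \<Union>(K ` V) \<union> (\<Union>e\<in>D. path_image (\<gamma> e))"

lemma compact_skeleton:
  assumes "blob_drawing V E K \<gamma>" "finite V" "finite D" "D \<subseteq> E"
  shows "compact (skeleton V D K \<gamma>)"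
proof (intro compact_Un compact_UN)
  show "compact (K x)" if "x \<in> V" for x using blob_drawingD(1)[OF assms(1) that] .
  show "compact (path_image (\<gamma> e))" if "e \<in> D" for e
    using blob_drawingD(6)[OF assms(1)] assms(4) that by (auto simp: compact_arc_image)
qed (use assms in auto)

lemma arc_ends_in_blobs:
  assumes "blob_drawing V E K \<gamma>" "e \<in> E"
  shows "pathstart (\<gamma> e) \<in> \<Union>(K ` V)" "pathfinish (\<gamma> e) \<in> \<Union>(K ` V)"
proof -
  obtain x y where "x \<in> V" "y \<in> V" "pathstart (\<gamma> e) \<in> K x" "pathfinish (\<gamma> e) \<in> K y"
    using blob_drawingD(8)[OF assms] by auto
  then show "pathstart (\<gamma> e) \<in> \<Union>(K ` V)" "pathfinish (\<gamma> e) \<in> \<Union>(K ` V)"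
    by auto
qed

lemma arc_inner_disjoint_skeleton:
  assumes "blob_drawing V E K \<gamma>" "e \<in> E" "D \<subseteq> E" "e \<notin> D"
  shows "arc_inner (\<gamma> e) \<inter> skeleton V D K \<gamma> = {}"
proof -
  have "arc_inner (\<gamma> e) \<inter> path_image (\<gamma> d) = {}" if "d \<in> D" for d
  proof -
    have "d \<in> E" "e \<noteq> d" using that assms by auto
    then have "arc_inner (\<gamma> e) \<inter> arc_inner (\<gamma> d) = {}"
      using blob_drawingD(9)[OF assms(1,2)] by blast
    then show ?thesis
      using arc_ends_in_blobs[OF assms(1) \<open>d \<in> E\<close>] blob_drawingD(7)[OF assms(1,2)] by blast
  qed
  then show ?thesis using blob_drawingD(7)[OF assms(1,2)] by blast
qed

lemma blobs_nonseparating: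
  assumes "finite V" "blob_drawing V E K \<gamma>"
  shows "connected (- \<Union>(K ` V))"
proof -
  have "connected (- \<Union>(K ` W))" if "W \<subseteq> V" for W
    using finite_subset[OF that assms(1)] that
  proof (induction W rule: finite_induct)
    case (insert x W)
    note D = blob_drawingD[OF assms(2)]
    have "K x \<inter> \<Union>(K ` W) = {}"
    proof -
      have "K x \<inter> K y = {}" if "y \<in> W" for y
        using D(5)[of x y] insert that by blast
      then show ?thesis by blast
    qed
    moreover have "compact (\<Union>(K ` W))"
      using D(1) insert by (intro compact_UN) auto
    ultimately have "connected (- (K x \<union> \<Union>(K ` W)))"
      using insert D(1,3) by (intro Janiszewski_connected compact_imp_closed) auto
    then show ?case by simp
  qed (simp add: convex_connected)
  then show ?thesis by blast
qed

text \<open>Without a leaf, an edge extends to a walk c, b, a, b', c'. The sides make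
  \<open>c\<close> differ from \<open>b'\<close> and \<open>c'\<close> from \<open>b\<close>, so its
  four edges are distinct even if \<open>c = c'\<close>.\<close>

lemma few_edges_have_leaf:
  fixes D :: "'a set set" and side :: "'a \<Rightarrow> bool"
  assumes "D \<noteq> {}" "card D \<le> 3" "finite D" and two: "\<And>e. e \<in> D \<Longrightarrow> card e = 2"
    and side: "\<And>x y. {x, y} \<in> D \<Longrightarrow> side x \<noteq> side y"
  shows "\<exists>x y. {x, y} \<in> D \<and> (\<forall>e\<in>D. x \<in> e \<longrightarrow> e = {x, y})"
proof (rule ccontr)
  assume no: "\<not> ?thesis"
  have more: "\<exists>z. {x, z} \<in> D \<and> z \<noteq> y" if "{x, y} \<in> D" for x y
  proof (rule ccontr)
    assume n: "\<not> ?thesis"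
    have "e = {x, y}" if "e \<in> D" "x \<in> e" for e
    proof -
      obtain z where "e = {x, z}" using two[OF \<open>e \<in> D\<close>] \<open>x \<in> e\<close> by (auto simp: card_2_iff)
      then show ?thesis using n that by blast
    qed
    then show False using no that \<open>{x, y} \<in> D\<close> by blast
  qed
  obtain a b where ab: "{a, b} \<in> D" 
  proof -
    obtain e where "e \<in> D" using \<open>D \<noteq> {}\<close> by blast
    then show thesis using that two[of e] by (auto simp: card_2_iff)
  qed
  obtain b' where b': "{a, b'} \<in> D" "b' \<noteq> b" using more[OF ab] by blast
  obtain c where c: "{b, c} \<in> D" "c \<noteq> a" using more[of b a] ab by (auto simp: insert_commute)
  obtain c' where c': "{b', c'} \<in> D" "c' \<noteq> a" using more[of b' a] b' by (auto simp: insert_commute)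
  have s: "side b \<noteq> side a" "side b' \<noteq> side a" "side c \<noteq> side b" "side c' \<noteq> side b'"
    using side[OF ab] side[OF b'(1)] side[OF c(1)] side[OF c'(1)] by auto
  then have "b \<noteq> a" "b' \<noteq> a" "c \<noteq> b" "c' \<noteq> b'" "c \<noteq> b'" "c' \<noteq> b" by auto
  then have four: "card {{a, b}, {a, b'}, {b, c}, {b', c'}} = 4"
    using b'(2) c(2) c'(2) by (auto simp: card_insert_if doubleton_eq_iff)
  have "{{a, b}, {a, b'}, {b, c}, {b', c'}} \<subseteq> D" using ab b' c c' by auto
  from card_mono[OF \<open>finite D\<close> this] show False using four assms(2) by linarith
qed

text \<open>A leaf is removed, and then its arc and its blob are attached again; each time the new
  set meets the old one in a single point, so nothing gets separated. Bipartiteness excludes a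
  triangle of three arcs.\<close>

lemma few_arcs_nonseparating:
  fixes side :: "'a \<Rightarrow> bool"
  assumes "blob_drawing V D K \<gamma>" "finite V" "finite D" "card D \<le> 3" "\<And>e. e \<in> D \<Longrightarrow> card e = 2"
    and "\<And>x y. {x, y} \<in> D \<Longrightarrow> side x \<noteq> side y"
  shows "connected (- skeleton V D K \<gamma>)"
  using assms
proof (induction "card D" arbitrary: D V)
  case 0
  then have "D = {}" by simp
  then show ?case using blobs_nonseparating[OF 0(3,2)] by simp
next
  case (Suc n)
  note d = Suc.prems(1)
  note B = blob_drawingD[OF d]
  have "D \<noteq> {}" using Suc.hyps(2) by auto
  have "\<exists>x y. {x, y} \<in> D \<and> (\<forall>e\<in>D. x \<in> e \<longrightarrow> e = {x, y})"
    by (rule few_edges_have_leaf[of D side]) (use Suc.prems \<open>D \<noteq> {}\<close> in auto)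
  then obtain x y where xy: "{x, y} \<in> D" and leaf: "\<And>e. e \<in> D \<Longrightarrow> x \<in> e \<Longrightarrow> e = {x, y}"
    by blast
  have "x \<noteq> y" using Suc.prems(5)[OF xy] by auto
  let ?V = "V - {x}" and ?D = "D - {{x, y}}" and ?P = "path_image (\<gamma> {x, y})"
  let ?S = "skeleton ?V ?D K \<gamma>"
  obtain u v where uv: "u \<in> V" "v \<in> V" "{x, y} = {u, v}" "pathstart (\<gamma> {x, y}) \<in> K u" "pathfinish (\<gamma> {x, y}) \<in> K v"
    using B(8)[OF xy] by blast
  then have xV: "x \<in> V" "y \<in> V" by (auto simp: doubleton_eq_iff)
  have in_V: "e \<subseteq> V" if "e \<in> D" for e using B(8)[OF that] by auto
  have d': "blob_drawing ?V ?D K \<gamma>"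
  proof (rule blob_drawing_subgraph[OF d])
    show "e \<subseteq> V - {x}" if "e \<in> D - {{x, y}}" for e
      using in_V leaf that by auto
  qed auto
  have "connected (- ?S)"
    using Suc xy by (intro Suc.hyps(1)[OF _ d']) auto
  have compact_S: "compact ?S"
    using compact_skeleton[OF d', of ?D] Suc.prems(2,3) by simp
  have KxS: "K x \<inter> ?S = {}"
  proof -
    have blobs: "K x \<inter> \<Union>(K ` ?V) = {}"
    proof -
      have "K x \<inter> K z = {}" if "z \<in> ?V" for z using B(5)[of x z] xV that by blast
      then show ?thesis by blast
    qed
    have "K x \<inter> path_image (\<gamma> e) = {}" if "e \<in> ?D" for e
    proof -
      have "arc_inner (\<gamma> e) \<inter> K x = {}" using B(7)[of e] that xV by blast
      then show ?thesis using arc_ends_in_blobs[OF d' that] blobs by blast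
    qed
    then show ?thesis using blobs by blast
  qed
  have innerS: "arc_inner (\<gamma> {x, y}) \<inter> ?S = {}"
    using arc_inner_disjoint_skeleton[OF d xy, of ?D] by auto
  have inner_x: "arc_inner (\<gamma> {x, y}) \<inter> K x = {}" using B(7)[OF xy] xV by blast
  obtain p q where pq: "{p, q} = {pathstart (\<gamma> {x, y}), pathfinish (\<gamma> {x, y})}" "p \<in> K x" "q \<in> K y"
  proof -
    have "u = x \<and> v = y \<or> u = y \<and> v = x" using uv(3) by (auto simp: doubleton_eq_iff)
    then show thesis
    proof
      assume "u = x \<and> v = y"
      then show thesis using that[of "pathstart (\<gamma> {x, y})" "pathfinish (\<gamma> {x, y})"] uv(4,5) by simp
    next
      assume "u = y \<and> v = x"
      then show thesis
        using that[of "pathfinish (\<gamma> {x, y})" "pathstart (\<gamma> {x, y})"] uv(4,5) insert_commute by metis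
    qed
  qed
  have P: "?P = insert p (insert q (arc_inner (\<gamma> {x, y})))"
  proof -
    have "?P = {p, q} \<union> arc_inner (\<gamma> {x, y})" unfolding pq(1) by auto
    then show ?thesis by simp
  qed
  have aux: "P \<inter> S = {q}" "q \<notin> A \<Longrightarrow> (S \<union> P) \<inter> A = {p}"
    if "P = insert p (insert q I)" "I \<inter> S = {}" "I \<inter> A = {}" "A \<inter> S = {}" "p \<in> A" "q \<in> S"
    for P S A I :: "complex set"
    using that by blast+
  have "q \<in> ?S" using pq(3) xV \<open>x \<noteq> y\<close> by auto
  note PS = aux[OF P innerS inner_x KxS pq(2) this]
  have conn_SP: "connected (- (?S \<union> ?P))"
    by (rule arc_attach_nonseparating[OF compact_S \<open>connected (- ?S)\<close> B(6)[OF xy]])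
       (simp only: PS(1) connected_sing)
  have "q \<notin> K x" using B(5)[OF xV \<open>x \<noteq> y\<close>] pq(3) by blast
  then have Kx: "(?S \<union> ?P) \<inter> K x = {p}" by (rule PS(2))
  have "connected ((?S \<union> ?P) \<inter> K x)" unfolding Kx by (rule connected_sing)
  then have nonsep: "connected (- (?S \<union> ?P \<union> K x))"
    using Janiszewski_connected[OF compact_Un[OF compact_S compact_arc_image[OF B(6)[OF xy]]]
        compact_imp_closed[OF B(1)[OF xV(1)]] _ conn_SP B(3)[OF xV(1)]] by blast
  have "\<Union>(K ` V) = K x \<union> \<Union>(K ` ?V)" using xV by blast
  moreover have "(\<Union>e\<in>D. path_image (\<gamma> e)) = ?P \<union> (\<Union>e\<in>?D. path_image (\<gamma> e))" using xy by blast
  ultimately have "skeleton V D K \<gamma> = ?S \<union> ?P \<union> K x" by (simp only: Un_ac)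
  then show ?case using nonsep by (simp only:)
qed

text \<open>If at most three arcs bordered the face \<open>F\<close> of \<open>p\<close>, the blobs
  and these arcs alone, forming \<open>Z\<close>, would not separate the plane. But a frontier point
  of \<open>F\<close> lies in a blob or on an arc bordering \<open>F\<close>, so \<open>F\<close> is
  relatively clopen in \<open>- Z\<close> and would contain \<open>q\<close>. With only one face the
  bound can fail, whence \<open>q\<close>.\<close>

lemma face_borders_four_arcs:
  fixes side :: "'a \<Rightarrow> bool"
  assumes d: "blob_drawing V E K \<gamma>" and fin: "finite V" "finite E"
    and two: "\<And>e. e \<in> E \<Longrightarrow> card e = 2" and side: "\<And>x y. {x, y} \<in> E \<Longrightarrow> side x \<noteq> side y"
    and p: "p \<in> - skeleton V E K \<gamma>" and q: "q \<in> - skeleton V E K \<gamma>"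
    and sep: "\<not> connected_component (- skeleton V E K \<gamma>) p q"
  shows "4 \<le> card {e \<in> E. arc_inner (\<gamma> e) \<inter> closure (connected_component_set (- skeleton V E K \<gamma>) p) \<noteq> {}}"
proof (rule ccontr)
  define Y where "Y = skeleton V E K \<gamma>"
  define F where "F = connected_component_set (- Y) p"
  define B where "B = {e \<in> E. arc_inner (\<gamma> e) \<inter> closure F \<noteq> {}}"
  assume "\<not> ?thesis"
  then have "card B \<le> 3" by (simp add: B_def F_def Y_def)
  have "B \<subseteq> E" by (auto simp: B_def)
  have e_sub: "e \<subseteq> V" if "e \<in> E" for e using blob_drawingD(8)[OF d that] by auto
  have dB: "blob_drawing V B K \<gamma>"
    by (rule blob_drawing_subgraph[OF d]) (use \<open>B \<subseteq> E\<close> e_sub in auto)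
  define Z where "Z = skeleton V B K \<gamma>"
  have conn: "connected (- Z)"
    unfolding Z_def
    by (rule few_arcs_nonseparating[OF dB fin(1) finite_subset[OF \<open>B \<subseteq> E\<close> fin(2)] \<open>card B \<le> 3\<close>, of side])
       (use two side \<open>B \<subseteq> E\<close> in auto)
  have "closed Y" unfolding Y_def using compact_skeleton[OF d fin] by (simp add: compact_imp_closed)
  have "closed Z" unfolding Z_def
    using compact_skeleton[OF dB fin(1) finite_subset[OF \<open>B \<subseteq> E\<close> fin(2)]] by (simp add: compact_imp_closed)
  have "Z \<subseteq> Y" unfolding Y_def Z_def using \<open>B \<subseteq> E\<close> by auto
  have "open F" unfolding F_def using \<open>closed Y\<close> by (simp add: open_Compl open_connected_component)
  have cover: "- Z \<subseteq> F \<union> (- closure F)"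
  proof
    fix s assume "s \<in> - Z"
    show "s \<in> F \<union> - closure F"
    proof (rule ccontr)
      assume "s \<notin> F \<union> - closure F"
      then have s: "s \<notin> F" "s \<in> closure F" by auto
      have "s \<in> Y"
      proof (rule ccontr)
        assume "s \<notin> Y"
        then have "open (connected_component_set (- Y) s)" "s \<in> connected_component_set (- Y) s"
          using \<open>closed Y\<close> by (auto intro: open_connected_component simp: connected_component_refl_eq)
        then obtain t where t: "t \<in> F" "connected_component (- Y) s t"
          using s(2) by (metis closure_iff_nhds_not_empty disjoint_iff mem_Collect_eq order_refl)
        then have "connected_component (- Y) p s"
          using connected_component_trans[OF _ connected_component_sym[OF t(2)]] by (simp add: F_def)
        then show False using s(1) by (simp add: F_def)
      qed
      then obtain e where e: "e \<in> E" "s \<in> path_image (\<gamma> e)" "e \<notin> B"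
        using \<open>s \<in> - Z\<close> unfolding Y_def Z_def by blast
      have "s \<noteq> pathstart (\<gamma> e)" "s \<noteq> pathfinish (\<gamma> e)"
        using arc_ends_in_blobs[OF d e(1)] \<open>s \<in> - Z\<close> unfolding Z_def by blast+
      then have "e \<in> B" using e(1,2) s(2) by (auto simp: B_def)
      then show False using e(3) by simp
    qed
  qed
  have "F \<inter> - closure F \<inter> - Z = {}" using closure_subset[of F] by auto
  then have "F \<inter> - Z = {} \<or> - closure F \<inter> - Z = {}"
    using connectedD[OF conn \<open>open F\<close> _ _ cover] by (simp add: open_Compl)
  moreover have "p \<in> F" "p \<in> - Z" using p \<open>Z \<subseteq> Y\<close> by (auto simp: F_def Y_def connected_component_refl_eq)
  ultimately have "- Z \<subseteq> F" using cover by auto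
  moreover have "q \<in> - Z" using q \<open>Z \<subseteq> Y\<close> by (auto simp: Y_def)
  ultimately show False using sep by (auto simp: F_def Y_def)
qed

text \<open>Once the arc is removed, all faces bordering it lie in one component, since each reaches
  the connected inner arc. Three of them would contradict \<open>arc_two_sides\<close>.\<close>

lemma arc_borders_two_faces:
  assumes d: "blob_drawing V E K \<gamma>" and fin: "finite V" "finite E" and e: "e \<in> E"
    and P: "finite P" "P \<subseteq> - skeleton V E K \<gamma>"
      "pairwise (\<lambda>a b. \<not> connected_component (- skeleton V E K \<gamma>) a b) P"
  shows "card {p \<in> P. arc_inner (\<gamma> e) \<inter> closure (connected_component_set (- skeleton V E K \<gamma>) p) \<noteq> {}} \<le> 2"
proof (rule ccontr)
  define I where "I = arc_inner (\<gamma> e)"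
  define Y where "Y = skeleton V E K \<gamma>"
  define S where "S = skeleton V (E - {e}) K \<gamma>"
  define B where "B = {p \<in> P. I \<inter> closure (connected_component_set (- Y) p) \<noteq> {}}"
  assume "\<not> ?thesis"
  then have "3 \<le> card B" by (simp add: B_def Y_def I_def)
  then obtain T where T: "T \<subseteq> B" "card T = 3" by (meson obtain_subset_with_card_n)
  from T(2) obtain x y z where "T = {x, y, z}" "x \<noteq> y" "x \<noteq> z" "y \<noteq> z"
    unfolding card_3_iff by blast
  then have xyz: "x \<in> B" "y \<in> B" "z \<in> B" "x \<noteq> y" "x \<noteq> z" "y \<noteq> z"
    using T(1) by auto
  have "(\<Union>d\<in>E. path_image (\<gamma> d)) = (\<Union>d\<in>E - {e}. path_image (\<gamma> d)) \<union> path_image (\<gamma> e)"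
    using e by blast
  then have YS: "Y = S \<union> path_image (\<gamma> e)" unfolding Y_def S_def by (simp only: Un_assoc)
  have "compact S" unfolding S_def using compact_skeleton[OF d fin(1), of "E - {e}"] fin(2) by auto
  have inner: "I \<inter> S = {}"
    unfolding S_def I_def by (rule arc_inner_disjoint_skeleton[OF d e]) auto
  have ends: "pathstart (\<gamma> e) \<in> S" "pathfinish (\<gamma> e) \<in> S"
    unfolding S_def using arc_ends_in_blobs[OF d e] by (auto simp only: Un_iff)
  have arc: "arc (\<gamma> e)" by (rule blob_drawingD(6)[OF d e])
  have "connected I"
    unfolding I_def by (rule connected_simple_path_endless[OF arc_imp_simple_path[OF arc]])
  moreover have "I \<subseteq> - S" using inner by (simp only: disjoint_eq_subset_Compl)
  ultimately have inner_conn: "connected_component (- S) s t"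
    if "s \<in> I" "t \<in> I" for s t
    using that unfolding connected_component_def by (intro exI[of _ I] conjI)
  have reach: "\<exists>s \<in> I. connected_component (- S) p s" if pB: "p \<in> B" for p
  proof -
    obtain s where s: "s \<in> I" "s \<in> closure (connected_component_set (- Y) p)"
      using pB by (auto simp: B_def)
    have "s \<notin> S" using s(1) inner by auto
    then have "open (connected_component_set (- S) s)" "s \<in> connected_component_set (- S) s"
      using compact_imp_closed[OF \<open>compact S\<close>]
      by (auto intro: open_connected_component simp: connected_component_refl_eq)
    then obtain t where t: "connected_component (- Y) p t" "connected_component (- S) s t"
      using s(2) by (metis closure_iff_nhds_not_empty disjoint_iff mem_Collect_eq order_refl)
    have "connected_component (- S) p t"
      using connected_component_of_subset[OF t(1)] YS by blast
    then show ?thesis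
      using s(1) connected_component_trans[OF _ connected_component_sym[OF t(2)]] by blast
  qed
  have same: "connected_component (- S) p q" if pq: "p \<in> B" "q \<in> B" for p q
  proof -
    obtain s where s: "s \<in> I" "connected_component (- S) p s" using reach[OF pq(1)] by blast
    obtain t where t: "t \<in> I" "connected_component (- S) q t" using reach[OF pq(2)] by blast
    show ?thesis
      using connected_component_trans[OF connected_component_trans[OF s(2) inner_conn[OF s(1) t(1)]]
          connected_component_sym[OF t(2)]] .
  qed
  have out: "p \<notin> path_image (\<gamma> e)" if "p \<in> B" for p
  proof -
    have "p \<in> - Y" using that P(2) by (auto simp: B_def Y_def)
    then show ?thesis by (simp add: YS)
  qed
  have "connected_component (- Y) x y \<or> connected_component (- Y) x z \<or> connected_component (- Y) y z"
    unfolding YS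
    by (rule arc_two_sides[OF \<open>compact S\<close> arc ends inner[unfolded I_def] same[OF xyz(1,3)] same[OF xyz(2,3)]
          out[OF xyz(1)] out[OF xyz(2)] out[OF xyz(3)]])
  moreover have "\<not> connected_component (- Y) p q" if "p \<in> B" "q \<in> B" "p \<noteq> q" for p q
    using P(3) that by (simp add: pairwise_def B_def Y_def)
  ultimately show False using xyz by blast
qed

text \<open>The lower bound on the number of faces, which are counted by representative points.
  Maximality of \<open>Fo\<close> says that an arc separates when added to \<open>Fo\<close> alone;
  \<open>split_face\<close> turns this into a new face at every stage, whatever arcs are already
  present.\<close>

lemma exists_separated_points:
  assumes d: "blob_drawing V E K \<gamma>" and fin: "finite V" "finite E"
    and "Fo \<subseteq> E" and conn: "connected (- skeleton V Fo K \<gamma>)" and ne: "- skeleton V Fo K \<gamma> \<noteq> {}"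
    and max: "\<And>e. e \<in> E - Fo \<Longrightarrow> \<not> connected (- skeleton V (insert e Fo) K \<gamma>)"
  obtains P where "finite P" "P \<subseteq> - skeleton V E K \<gamma>"
      "pairwise (\<lambda>a b. \<not> connected_component (- skeleton V E K \<gamma>) a b) P" "card (E - Fo) < card P"
proof -
  define good where "good D P \<longleftrightarrow> finite P \<and> P \<subseteq> - skeleton V (Fo \<union> D) K \<gamma> \<and>
    pairwise (\<lambda>a b. \<not> connected_component (- skeleton V (Fo \<union> D) K \<gamma>) a b) P \<and> card D < card P" for D P
  have "\<exists>P. good D P" if "D \<subseteq> E - Fo" for D
    using finite_subset[OF that finite_Diff[OF fin(2)]] that
  proof (induction D rule: finite_induct)
    case empty
    obtain p where "p \<in> - skeleton V Fo K \<gamma>" using ne by blast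
    then have "good {} {p}" by (simp add: good_def)
    then show ?case by blast
  next
    case (insert e D)
    then obtain P where P: "good D P" by blast
    have e: "e \<in> E" "e \<notin> Fo \<union> D" and D: "Fo \<union> D \<subseteq> E" using insert assms(4) by auto
    have clos: "closed (skeleton V D' K \<gamma>)" if "D' \<subseteq> E" for D'
      using compact_skeleton[OF d fin(1) finite_subset[OF that fin(2)] that] by (rule compact_imp_closed)
    have ins: "skeleton V D' K \<gamma> \<union> path_image (\<gamma> e) = skeleton V (insert e D') K \<gamma>" for D' by blast
    have nconn: "\<not> connected (- (skeleton V Fo K \<gamma> \<union> path_image (\<gamma> e)))"
      unfolding ins using max e by blast
    have ends: "pathstart (\<gamma> e) \<in> skeleton V Fo K \<gamma>" "pathfinish (\<gamma> e) \<in> skeleton V Fo K \<gamma>"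
      using arc_ends_in_blobs[OF d e(1)] by blast+
    have sub: "skeleton V Fo K \<gamma> \<subseteq> skeleton V (Fo \<union> D) K \<gamma>" by auto
    note P' = P[unfolded good_def]
    obtain P' where "finite P'" "P' \<subseteq> - (skeleton V (Fo \<union> D) K \<gamma> \<union> path_image (\<gamma> e))"
      "pairwise (\<lambda>a b. \<not> connected_component (- (skeleton V (Fo \<union> D) K \<gamma> \<union> path_image (\<gamma> e))) a b) P'"
      "card P < card P'"
      using split_face[OF sub clos[OF D] clos[OF assms(4)] blob_drawingD(6)[OF d e(1)]
          arc_inner_disjoint_skeleton[OF d e(1) D e(2)] ends conn nconn] P' by metis
    then have "good (insert e D) P'"
      using insert.hyps P' unfolding ins good_def by simp
    then show ?case by blast
  qed
  then obtain P where "good (E - Fo) P" by blast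
  moreover have "Fo \<union> (E - Fo) = E" using assms(4) by blast
  ultimately show thesis using that unfolding good_def by metis
qed

text \<open>With m edges, n blobs and f representative points of faces, the bound follows from m -
  |Fo| < f, 4 f \<le> 2 m and |Fo| < n.\<close>

theorem bipartite_blob_sparse:
  fixes side :: "'a \<Rightarrow> bool"
  assumes "blob_planar V E" "finite V" "V \<noteq> {}"
    and two: "\<And>e. e \<in> E \<Longrightarrow> card e = 2" and side: "\<And>x y. {x, y} \<in> E \<Longrightarrow> side x \<noteq> side y"
  shows "card E < 2 * card V"
proof -
  obtain K \<gamma> where d: "blob_drawing V E K \<gamma>" using assms(1) unfolding blob_planar_def by blast
  note D = blob_drawingD[OF d]
  have e_sub: "e \<subseteq> V" if "e \<in> E" for e using D(8)[OF that] by auto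
  then have "E \<subseteq> Pow V" by blast
  then have "finite E" using \<open>finite V\<close> by (meson finite_Pow_iff finite_subset)
  define \<F> where "\<F> = {Fo. Fo \<subseteq> E \<and> connected (- skeleton V Fo K \<gamma>)}"
  have "finite \<F>" unfolding \<F>_def by (rule finite_subset[of _ "Pow E"]) (use \<open>finite E\<close> in auto)
  moreover have "{} \<in> \<F>" using blobs_nonseparating[OF \<open>finite V\<close> d] by (simp add: \<F>_def)
  \<comment> \<open>\<open>Fo\<close> takes the part of a spanning forest.\<close>
  ultimately obtain Fo where Fo: "Fo \<in> \<F>" and max: "\<forall>G\<in>\<F>. Fo \<subseteq> G \<longrightarrow> Fo = G"
    using finite_has_maximal[of \<F>] by blast
  have FoE: "Fo \<subseteq> E" "connected (- skeleton V Fo K \<gamma>)" using Fo by (auto simp: \<F>_def)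
  have "inj_on K V"
  proof (rule inj_onI, rule ccontr)
    fix x y assume "x \<in> V" "y \<in> V" "K x = K y" "x \<noteq> y"
    then show False using D(5)[of x y] D(4)[of x] by auto
  qed
  have "card Fo < card (K ` V)"
  proof (rule nonseparating_arcs_card)
    show "finite Fo" using FoE(1) \<open>finite E\<close> by (rule finite_subset)
    show "disjoint (K ` V)" using D(5) by (auto simp: disjoint_def)
    show "compact B \<and> connected B \<and> B \<noteq> {}" if "B \<in> K ` V" for B using that D(1,2,4) by auto
    show "arc (\<gamma> e) \<and> pathstart (\<gamma> e) \<in> \<Union>(K ` V) \<and> pathfinish (\<gamma> e) \<in> \<Union>(K ` V) \<and> arc_inner (\<gamma> e) \<inter> \<Union>(K ` V) = {}"
      if "e \<in> Fo" for e
    proof -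
      have "e \<in> E" using that FoE(1) by blast
      then show ?thesis using D(6,7) arc_ends_in_blobs[OF d] by (intro conjI)
    qed
    show "arc_inner (\<gamma> e) \<inter> arc_inner (\<gamma> e') = {}" if "e \<in> Fo" "e' \<in> Fo" "e \<noteq> e'" for e e'
      using that FoE(1) by (intro D(9)) auto
  qed (use assms FoE in auto)
  then have card_Fo: "card Fo < card V" using \<open>inj_on K V\<close> by (simp add: card_image)
  have nconn: "\<not> connected (- skeleton V (insert e Fo) K \<gamma>)" if "e \<in> E - Fo" for e
  proof
    assume "connected (- skeleton V (insert e Fo) K \<gamma>)"
    then have "insert e Fo \<in> \<F>" using that FoE(1) by (simp add: \<F>_def)
    then show False using max that by blast
  qed
  have "compact (skeleton V Fo K \<gamma>)"
    by (rule compact_skeleton[OF d \<open>finite V\<close> finite_subset[OF FoE(1) \<open>finite E\<close>] FoE(1)])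
  then have "- skeleton V Fo K \<gamma> \<noteq> {}"
    using compact_imp_bounded not_bounded_UNIV by (metis double_compl Compl_empty_eq)
  then obtain P where P: "finite P" "P \<subseteq> - skeleton V E K \<gamma>"
      "pairwise (\<lambda>a b. \<not> connected_component (- skeleton V E K \<gamma>) a b) P" "card (E - Fo) < card P"
    using exists_separated_points[OF d \<open>finite V\<close> \<open>finite E\<close> FoE _ nconn] by blast
  have cards: "card (E - Fo) = card E - card Fo" "card Fo \<le> card E"
    using FoE(1) \<open>finite E\<close> by (auto simp: card_Diff_subset finite_subset card_mono)
  show ?thesis
  proof (cases "2 \<le> card P")
    \<comment> \<open>Four arcs per face are guaranteed only if there are two faces; with at most
      one point in \<open>P\<close>, however, \<open>Fo\<close> is all of \<open>E\<close>.\<close>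
    case False
    then show ?thesis using P(4) cards card_Fo by linarith
  next
    case True
    let ?R = "\<lambda>p e. arc_inner (\<gamma> e) \<inter> closure (connected_component_set (- skeleton V E K \<gamma>) p) \<noteq> {}"
    have four: "4 \<le> card {e \<in> E. ?R p e}" if "p \<in> P" for p
    proof -
      obtain q where q: "q \<in> P" "q \<noteq> p"
        using True P(1) \<open>p \<in> P\<close> by (metis card_le_Suc0_iff_eq not_less_eq_eq numeral_2_eq_2)
      have pq: "p \<in> - skeleton V E K \<gamma>" "q \<in> - skeleton V E K \<gamma>"
        using P(2) \<open>p \<in> P\<close> q(1) by (simp_all only: subset_iff)
      have sep: "\<not> connected_component (- skeleton V E K \<gamma>) p q"
        using P(3) \<open>p \<in> P\<close> q by (simp only: pairwise_def) blast
      show ?thesis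
        by (rule face_borders_four_arcs[where side = side and q = q, OF d \<open>finite V\<close> \<open>finite E\<close> _ _ pq sep])
           (use two side in auto)
    qed
    have "4 * card P \<le> (\<Sum>p\<in>P. card {e \<in> E. ?R p e})"
      using sum_mono[of P "\<lambda>_. 4" "\<lambda>p. card {e \<in> E. ?R p e}"] four by simp
    also have "\<dots> = (\<Sum>e\<in>E. card {p \<in> P. ?R p e})"
      by (rule sum_multicount_gen[OF \<open>finite P\<close> \<open>finite E\<close>]) simp
    also have "\<dots> \<le> (\<Sum>e\<in>E. 2)"
      by (intro sum_mono arc_borders_two_faces[OF d \<open>finite V\<close> \<open>finite E\<close> _ P(1-3)])
    finally have "4 * card P \<le> 2 * card E" by simp
    then show ?thesis using P(4) cards card_Fo by linarith
  qed
qed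

section \<open>Recolouring sequences\<close>

definition nbrs :: "'a set set \<Rightarrow> 'a \<Rightarrow> 'a set" where
  "nbrs E v = {u. {u, v} \<in> E}"

definition del_verts :: "'a set \<Rightarrow> 'a set set \<Rightarrow> 'a set set" where
  "del_verts W E = {e \<in> E. e \<inter> W = {}}"

lemma nbrs_sym: "u \<in> nbrs E v \<longleftrightarrow> v \<in> nbrs E u"
  by (simp add: nbrs_def insert_commute)

lemma simple_graphD:
  assumes "simple_graph V E"
  shows "finite V" "finite E" "u \<in> nbrs E v \<Longrightarrow> u \<in> V" "u \<in> nbrs E v \<Longrightarrow> v \<in> V" "v \<notin> nbrs E v"
    "nbrs E v \<subseteq> V" "finite (nbrs E v)"
proof -
  show fin: "finite V" using assms by (simp add: simple_graph_def)
  have "E \<subseteq> Pow V" using assms by (auto simp: simple_graph_def)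
  then show "finite E" using fin by (simp add: finite_subset)
  show sub: "nbrs E v \<subseteq> V" using assms by (auto simp: simple_graph_def nbrs_def)
  then show "finite (nbrs E v)" using fin by (rule finite_subset)
  show "u \<in> nbrs E v \<Longrightarrow> u \<in> V" using sub by blast
  show "u \<in> nbrs E v \<Longrightarrow> v \<in> V" using assms by (auto simp: simple_graph_def nbrs_def)
  show "v \<notin> nbrs E v" using assms by (auto simp: simple_graph_def nbrs_def)
qed

lemma nbrs_del_verts: "v \<notin> W \<Longrightarrow> nbrs (del_verts W E) v = nbrs E v - W"
  by (auto simp: nbrs_def del_verts_def)

lemma simple_graph_del_verts: "simple_graph V E \<Longrightarrow> simple_graph (V - W) (del_verts W E)"
  by (auto simp: simple_graph_def del_verts_def)

text \<open>Extensionality is dropped, so that one function serves as a colouring of all graphs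
  obtained by deleting or identifying vertices.\<close>

definition proper :: "'a set \<Rightarrow> 'a set set \<Rightarrow> ('a \<Rightarrow> nat) \<Rightarrow> bool" where
  "proper V E f \<longleftrightarrow> (\<forall>v\<in>V. f v \<in> {1..5}) \<and> (\<forall>v. \<forall>u\<in>nbrs E v. f u \<noteq> f v)"

fun run :: "('a \<Rightarrow> nat) \<Rightarrow> ('a \<times> nat) list \<Rightarrow> 'a \<Rightarrow> nat" where
  "run f [] = f"
| "run f ((v, c) # ms) = run (f(v := c)) ms"

text \<open>A move may repeat the present colour of its vertex. This permits exact move counts; such
  moves are skipped in the passage to walks.\<close>

fun legal :: "'a set \<Rightarrow> 'a set set \<Rightarrow> ('a \<Rightarrow> nat) \<Rightarrow> ('a \<times> nat) list \<Rightarrow> bool" where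
  "legal V E f [] \<longleftrightarrow> True"
| "legal V E f ((v, c) # ms) \<longleftrightarrow>
     v \<in> V \<and> c \<in> {1..5} \<and> (\<forall>u\<in>nbrs E v. f u \<noteq> c) \<and> legal V E (f(v := c)) ms"

definition moves :: "('a \<times> nat) list \<Rightarrow> 'a set \<Rightarrow> nat" where
  "moves ms A = length (filter (\<lambda>m. fst m \<in> A) ms)"

lemma moves_simps [simp]:
  "moves [] A = 0"
  "moves ((v, c) # ms) A = (if v \<in> A then 1 else 0) + moves ms A"
  "moves (ms @ ms') A = moves ms A + moves ms' A"
  by (simp_all add: moves_def)

lemma run_append [simp]: "run f (ms @ ms') = run (run f ms) ms'"
proof (induction ms arbitrary: f)
  case (Cons m ms)
  then show ?case by (cases m) (simp del: fun_upd_apply)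
qed simp

lemma legal_append [simp]: "legal V E f (ms @ ms') \<longleftrightarrow> legal V E f ms \<and> legal V E (run f ms) ms'"
proof (induction ms arbitrary: f)
  case (Cons m ms)
  then show ?case by (cases m) (simp del: fun_upd_apply)
qed simp

lemma run_cong: "f v = g v \<Longrightarrow> run f ms v = run g ms v"
proof (induction ms arbitrary: f g)
  case (Cons m ms)
  obtain u c where m: "m = (u, c)" by fastforce
  have "(f(u := c)) v = (g(u := c)) v" using Cons.prems by simp
  from Cons.IH[of "f(u := c)" "g(u := c)", OF this] show ?case by (simp add: m del: fun_upd_apply)
qed simp

lemma run_not_moved: "moves ms {v} = 0 \<Longrightarrow> run f ms v = f v"
proof (induction ms arbitrary: f)
  case (Cons m ms)
  obtain u c where m: "m = (u, c)" by fastforce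
  have "u \<noteq> v" "moves ms {v} = 0" using Cons.prems by (auto simp: m split: if_splits)
  then show ?case
    using Cons.IH[of "f(u := c)", OF \<open>moves ms {v} = 0\<close>]
    by (simp add: m fun_upd_other del: fun_upd_apply)
qed simp

lemma legal_cong:
  assumes "simple_graph V E" "\<And>v. v \<in> V \<Longrightarrow> f v = g v"
  shows "legal V E f ms \<Longrightarrow> legal V E g ms"
  using assms(2)
proof (induction ms arbitrary: f g)
  case (Cons m ms)
  obtain v c where m: "m = (v, c)" by fastforce
  have v: "v \<in> V" "c \<in> {1..5}" "\<forall>u\<in>nbrs E v. f u \<noteq> c" and leg: "legal V E (f(v := c)) ms"
    using Cons.prems(1) unfolding m legal.simps by blast+
  have "legal V E (g(v := c)) ms"
    by (rule Cons.IH[OF leg]) (simp add: Cons.prems(2))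
  moreover have "g u \<noteq> c" if "u \<in> nbrs E v" for u
    using v(3) that Cons.prems(2)[OF simple_graphD(3)[OF assms(1) that]] by auto
  ultimately show ?case using v unfolding m legal.simps by blast
qed simp

lemma proper_update:
  assumes "simple_graph V E" "proper V E f" "c \<in> {1..5}" "\<forall>u\<in>nbrs E v. f u \<noteq> c"
  shows "proper V E (f(v := c))"
  unfolding proper_def
proof (intro conjI allI ballI)
  show "(f(v := c)) w \<in> {1..5}" if "w \<in> V" for w using assms(2,3) that by (auto simp: proper_def)
  fix w u assume u: "u \<in> nbrs E w"
  then have "u \<noteq> w" "f u \<noteq> f w" using simple_graphD(5)[OF assms(1)] assms(2) by (auto simp: proper_def)
  moreover have "f u \<noteq> c" if "w = v" using assms(4) u that by blast
  moreover have "f w \<noteq> c" if "u = v" using assms(4) u that nbrs_sym[of w E] by blast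
  ultimately show "(f(v := c)) u \<noteq> (f(v := c)) w" by auto
qed

lemma legal_run_proper:
  assumes "simple_graph V E"
  shows "proper V E f \<Longrightarrow> legal V E f ms \<Longrightarrow> proper V E (run f ms)"
proof (induction ms arbitrary: f)
  case (Cons m ms)
  then show ?case by (cases m) (simp add: proper_update[OF assms] del: fun_upd_apply)
qed simp

lemma proper_del_verts: "proper V E f \<Longrightarrow> proper (V - W) (del_verts W E) f"
  by (auto simp: proper_def nbrs_def del_verts_def)

lemma moves_eq_sum: "finite A \<Longrightarrow> moves ms A = (\<Sum>v\<in>A. moves ms {v})"
proof (induction ms)
  case (Cons m ms)
  then show ?case by (cases m) (simp add: sum.distrib)
qed simp

section \<open>Lifting move sequences to larger graphs\<close>

lemma free_colour:
  assumes "finite A" "card A \<le> 4"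
  obtains c :: nat where "c \<in> {1..5}" "c \<notin> A"
proof -
  have "\<not> {1..5} \<subseteq> A"
    using card_mono[OF assms(1), of "{1..5}"] assms(2) by auto
  then show thesis using that by blast
qed

definition next_colour :: "'a set \<Rightarrow> ('a \<times> nat) list \<Rightarrow> nat option" where
  "next_colour A ms = map_option snd (find (\<lambda>m. fst m \<in> A) ms)"

text \<open>When a move of a neighbour forces \<open>v\<close> to change its colour, \<open>v\<close> avoids the colour that
  the next moving neighbour will take, so it moves at most once per two moves of its neighbours.\<close>
lemma lift_moves_over_vertex:
  fixes V :: "'a set"
  assumes G: "simple_graph V E" and v: "v \<in> V" "card (nbrs E v) \<le> 2"
  shows "proper V E f \<Longrightarrow> legal (V - {v}) (del_verts {v} E) f ms \<Longrightarrow>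
    \<exists>ms'. legal V E f ms' \<and> (\<forall>u. u \<noteq> v \<longrightarrow> run f ms' u = run f ms u \<and> moves ms' {u} = moves ms {u}) \<and>
      moves ms' {v} \<le> (moves ms (nbrs E v) + 1) div 2 \<and>
      (next_colour (nbrs E v) ms \<noteq> Some (f v) \<longrightarrow> moves ms' {v} \<le> moves ms (nbrs E v) div 2)"
proof (induction ms arbitrary: f)
  case Nil
  then show ?case by (intro exI[of _ "[]"]) simp
next
  case (Cons m ms)
  let ?N = "nbrs E v"
  note S = simple_graphD[OF G]
  obtain u c where m: "m = (u, c)" by fastforce
  have u: "u \<in> V" "u \<noteq> v" "c \<in> {1..5}" and leg: "legal (V - {v}) (del_verts {v} E) (f(u := c)) ms"
    using Cons.prems(2) m by auto
  have uc: "f x \<noteq> c" if "x \<in> nbrs E u" "x \<noteq> v" for x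
    using Cons.prems(2) m u that by (auto simp: nbrs_del_verts)
  show ?case
  proof (cases "u \<in> ?N \<and> c = f v")
    case True
    \<comment> \<open>At most four colours are excluded: the present one of \<open>v\<close>, two of
      its neighbours and the foreseen one. As \<open>d\<close> is not the foreseen colour, the
      sharper bound holds for the tail; with k moves of neighbours there, 1 + k div 2 = (k + 2) div
      2 is the bound rounded up.\<close>
    let ?A = "insert c (f ` ?N \<union> set_option (next_colour ?N ms))"
    have "card (f ` ?N) \<le> 2" using v(2) card_image_le[OF S(7)[of v], of f] by linarith
    moreover have "card (set_option (next_colour ?N ms)) \<le> 1" by (cases "next_colour ?N ms") auto
    ultimately have "card (f ` ?N \<union> set_option (next_colour ?N ms)) \<le> 3"
      using card_Un_le[of "f ` ?N" "set_option (next_colour ?N ms)"] by linarith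
    then have "card ?A \<le> 4"
      using S(7)[of v] by (simp add: card_insert_if)
    moreover have "finite ?A" using S(7)[of v] by simp
    ultimately obtain d where d: "d \<in> {1..5}" "d \<notin> ?A" using free_colour by blast
    define g where "g = f(v := d)"
    have g: "proper V E g"
      unfolding g_def by (rule proper_update[OF G Cons.prems(1) d(1)]) (use d(2) in auto)
    have gu: "\<forall>x\<in>nbrs E u. g x \<noteq> c"
      using uc d(2) by (auto simp: g_def)
    have "legal (V - {v}) (del_verts {v} E) (g(u := c)) ms"
      by (rule legal_cong[OF simple_graph_del_verts[OF G] _ leg]) (simp add: g_def)
    moreover have "proper V E (g(u := c))" by (rule proper_update[OF G g u(3) gu])
    moreover have "next_colour ?N ms \<noteq> Some ((g(u := c)) v)"
      using d(2) u(2) by (auto simp: g_def)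
    ultimately obtain ms' where ms': "legal V E (g(u := c)) ms'"
      "\<And>x. x \<noteq> v \<Longrightarrow> run (g(u := c)) ms' x = run (g(u := c)) ms x \<and> moves ms' {x} = moves ms {x}"
      "moves ms' {v} \<le> moves ms ?N div 2"
      using Cons.IH[of "g(u := c)"] by blast
    have "run (g(u := c)) ms x = run (f(u := c)) ms x" if "x \<noteq> v" for x
      using that by (intro run_cong) (simp add: g_def)
    moreover have "\<forall>x\<in>?N. f x \<noteq> d" using d(2) by auto
    ultimately show ?thesis
      using ms' u d(1) v(1) True gu m
      by (intro exI[of _ "(v, d) # (u, c) # ms'"]) (auto simp: g_def next_colour_def)
  next
    case False
    then have "f x \<noteq> c" if "x \<in> nbrs E u" for x
      using uc[OF that] that nbrs_sym[of u E v] by (cases "x = v") auto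
    then have p: "proper V E (f(u := c))" and ok: "\<forall>x\<in>nbrs E u. f x \<noteq> c"
      by (auto intro: proper_update[OF G Cons.prems(1) u(3)])
    obtain ms' where ms': "legal V E (f(u := c)) ms'"
      "\<And>x. x \<noteq> v \<Longrightarrow> run (f(u := c)) ms' x = run (f(u := c)) ms x \<and> moves ms' {x} = moves ms {x}"
      "moves ms' {v} \<le> (moves ms ?N + 1) div 2"
      "next_colour ?N ms \<noteq> Some ((f(u := c)) v) \<Longrightarrow> moves ms' {v} \<le> moves ms ?N div 2"
      using Cons.IH[OF p leg] by blast
    then show ?thesis
      using u ok False m by (intro exI[of _ "(u, c) # ms'"]) (auto simp: next_colour_def)
  qed
qed

text \<open>Three neighbours and \<open>c\<close> exclude at most four of the five colours. Each
  vertex of \<open>W\<close> is moved even if it already avoids \<open>c\<close>, which makes the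
  count exact.\<close>

lemma dodge_colour:
  fixes V :: "'a set"
  assumes G: "simple_graph V E" and "W \<subseteq> V" "finite W" and indep: "\<And>w w'. w \<in> W \<Longrightarrow> w' \<in> W \<Longrightarrow> w' \<notin> nbrs E w"
    and deg: "\<And>w. w \<in> W \<Longrightarrow> card (nbrs E w) \<le> 3" and f: "proper V E f"
  shows "\<exists>ms. legal V E f ms \<and> (\<forall>x. moves ms {x} = (if x \<in> W then 1 else 0)) \<and> (\<forall>w\<in>W. run f ms w \<noteq> c)"
  using \<open>finite W\<close> \<open>W \<subseteq> V\<close> indep deg
proof (induction W rule: finite_induct)
  case empty
  show ?case by (intro exI[of _ "[]"]) simp
next
  case (insert w W)
  note S = simple_graphD[OF G]
  obtain ms where ms: "legal V E f ms" "\<And>x. moves ms {x} = (if x \<in> W then 1 else 0)" "\<And>w. w \<in> W \<Longrightarrow> run f ms w \<noteq> c"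
    using insert.IH insert.prems by blast
  have "card (insert c (run f ms ` nbrs E w)) \<le> 4"
    using card_image_le[OF S(7)[of w], of "run f ms"] insert.prems(3)[of w]
    by (simp add: card_insert_if S(7))
  then obtain d where d: "d \<in> {1..5}" "d \<notin> insert c (run f ms ` nbrs E w)"
    using free_colour[of "insert c (run f ms ` nbrs E w)"] S(7) by blast
  then show ?case
    using ms insert.hyps insert.prems(1) by (intro exI[of _ "ms @ [(w, d)]"]) auto
qed

text \<open>Before \<open>u\<close> takes the colour \<open>c\<close>, its neighbours in
  \<open>Q\<close> evade \<open>c\<close>. So a vertex of \<open>Q\<close> moves once for each move
  of a neighbour.\<close>

lemma lift_moves_over_independent_set:
  fixes V :: "'a set"
  assumes G: "simple_graph V E" and "Q \<subseteq> V" and indep: "\<And>w w'. w \<in> Q \<Longrightarrow> w' \<in> Q \<Longrightarrow> w' \<notin> nbrs E w"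
    and deg: "\<And>w. w \<in> Q \<Longrightarrow> card (nbrs E w) \<le> 3"
  shows "proper V E f \<Longrightarrow> legal (V - Q) (del_verts Q E) f ms \<Longrightarrow>
    \<exists>ms'. legal V E f ms' \<and> (\<forall>u. u \<notin> Q \<longrightarrow> run f ms' u = run f ms u \<and> moves ms' {u} = moves ms {u}) \<and>
      (\<forall>w\<in>Q. moves ms' {w} \<le> moves ms (nbrs E w))"
proof (induction ms arbitrary: f)
  case Nil
  then show ?case by (intro exI[of _ "[]"]) simp
next
  case (Cons m ms)
  note S = simple_graphD[OF G]
  obtain u c where m: "m = (u, c)" by fastforce
  have u: "u \<in> V" "u \<notin> Q" "c \<in> {1..5}" and leg: "legal (V - Q) (del_verts Q E) (f(u := c)) ms"
    using Cons.prems(2) m by auto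
  have uc: "f x \<noteq> c" if "x \<in> nbrs E u" "x \<notin> Q" for x
    using Cons.prems(2) m u that by (auto simp: nbrs_del_verts)
  let ?W = "Q \<inter> nbrs E u"
  have "finite ?W" "?W \<subseteq> V" using S(1,6) \<open>Q \<subseteq> V\<close> by (auto intro: finite_subset)
  then obtain ms1 where ms1: "legal V E f ms1" "\<And>x. moves ms1 {x} = (if x \<in> ?W then 1 else 0)"
    "\<And>w. w \<in> ?W \<Longrightarrow> run f ms1 w \<noteq> c"
    using dodge_colour[OF G _ _ _ _ Cons.prems(1), of ?W c] indep deg by auto
  define g where "g = run f ms1"
  have g_eq: "g x = f x" if "x \<notin> ?W" for x
    unfolding g_def using ms1(2)[of x] that by (intro run_not_moved) simp
  have gp: "proper V E g" unfolding g_def by (rule legal_run_proper[OF G Cons.prems(1) ms1(1)])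
  have gu: "\<forall>x\<in>nbrs E u. g x \<noteq> c"
    using uc ms1(3) g_eq by (metis IntI g_def Int_iff)
  have "legal (V - Q) (del_verts Q E) (g(u := c)) ms"
    by (rule legal_cong[OF simple_graph_del_verts[OF G] _ leg]) (use g_eq in auto)
  with proper_update[OF G gp u(3) gu] obtain ms2 where ms2: "legal V E (g(u := c)) ms2"
      "\<And>x. x \<notin> Q \<Longrightarrow> run (g(u := c)) ms2 x = run (g(u := c)) ms x \<and> moves ms2 {x} = moves ms {x}"
      "\<And>w. w \<in> Q \<Longrightarrow> moves ms2 {w} \<le> moves ms (nbrs E w)"
    using Cons.IH[of "g(u := c)"] by blast
  have "run (g(u := c)) ms x = run (f(u := c)) ms x" if "x \<notin> Q" for x
    using that g_eq by (intro run_cong) auto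
  then show ?case
    using ms1 ms2 u gu m nbrs_sym[of u E] by (intro exI[of _ "ms1 @ (u, c) # ms2"]) (auto simp: g_def)
qed

lemma nbrs_absorb:
  assumes "{a, b} \<notin> E" "v \<noteq> b" "a \<noteq> b"
  shows "nbrs (absorb a b E) v =
    (if v = a then nbrs E a \<union> nbrs E b else nbrs E v - {b} \<union> (if b \<in> nbrs E v then {a} else {}))"
  using assms by (auto simp: nbrs_def absorb_def doubleton_eq_iff insert_commute)

text \<open>A move of the merged vertex is made by \<open>a\<close> and then by \<open>b\<close>. It
  is legal for both, since the merged vertex has the neighbours of both and \<open>a\<close>,
  \<open>b\<close> are not adjacent.\<close>

lemma lift_moves_over_identification:
  fixes V :: "'a set"
  assumes G: "simple_graph V E" and ab: "a \<noteq> b" "{a, b} \<notin> E" "a \<in> V" "b \<in> V"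
  shows "f a = f b \<Longrightarrow> legal (V - {b}) (absorb a b E) f ms \<Longrightarrow>
    \<exists>ms'. legal V E f ms' \<and> (\<forall>u. u \<noteq> b \<longrightarrow> run f ms' u = run f ms u \<and> moves ms' {u} = moves ms {u}) \<and>
      run f ms' b = run f ms a \<and> moves ms' {b} = moves ms {a}"
proof (induction ms arbitrary: f)
  case Nil
  then show ?case by (intro exI[of _ "[]"]) simp
next
  case (Cons m ms)
  note S = simple_graphD[OF G]
  obtain u c where m: "m = (u, c)" by fastforce
  have u: "u \<in> V" "u \<noteq> b" "c \<in> {1..5}" and leg: "legal (V - {b}) (absorb a b E) (f(u := c)) ms"
    and uc: "\<And>x. x \<in> nbrs (absorb a b E) u \<Longrightarrow> f x \<noteq> c"
    using Cons.prems(2) m by auto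
  have nab: "a \<notin> nbrs E b" "b \<notin> nbrs E a" using ab(2) by (auto simp: nbrs_def insert_commute)
  have leg_cong: "legal (V - {b}) (absorb a b E) (f(u := c, b := d)) ms" for d
  proof (rule legal_cong[OF _ _ leg])
    show "simple_graph (V - {b}) (absorb a b E)"
      using G ab nab by (auto simp: simple_graph_def absorb_def nbrs_def card_insert_if)
  qed auto
  show ?case
  proof (cases "u = a")
    case True
    let ?g = "f(a := c, b := c)"
    have eq: "?g a = ?g b" by simp
    have leg': "legal (V - {b}) (absorb a b E) ?g ms"
      using leg_cong[of c] True by (simp del: fun_upd_apply)
    obtain ms' where ms': "legal V E ?g ms'"
      "\<And>x. x \<noteq> b \<Longrightarrow> run ?g ms' x = run ?g ms x \<and> moves ms' {x} = moves ms {x}"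
      "run ?g ms' b = run ?g ms a" "moves ms' {b} = moves ms {a}"
      using Cons.IH[of ?g, OF eq leg'] by blast
    have "run ?g ms x = run (f(a := c)) ms x" if "x \<noteq> b" for x
      using that by (intro run_cong) auto
    then show ?thesis
      using ms' u m True uc ab nab nbrs_absorb[OF ab(2) ab(1) ab(1)]
      by (intro exI[of _ "(a, c) # (b, c) # ms'"]) auto
  next
    case False
    let ?g = "f(u := c)"
    have eq: "?g a = ?g b" using Cons.prems(1) False u by simp
    obtain ms' where ms': "legal V E ?g ms'"
      "\<And>x. x \<noteq> b \<Longrightarrow> run ?g ms' x = run ?g ms x \<and> moves ms' {x} = moves ms {x}"
      "run ?g ms' b = run ?g ms a" "moves ms' {b} = moves ms {a}"
      using Cons.IH[of ?g, OF eq leg] by blast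
    have N: "nbrs (absorb a b E) u = nbrs E u - {b} \<union> (if b \<in> nbrs E u then {a} else {})"
      using nbrs_absorb[OF ab(2) u(2) ab(1)] False by simp
    have "f x \<noteq> c" if x: "x \<in> nbrs E u" for x
    proof (cases "x = b")
      case True
      then have "a \<in> nbrs (absorb a b E) u" using x by (simp add: N)
      then show ?thesis using uc True Cons.prems(1) by metis
    next
      case False
      then have "x \<in> nbrs (absorb a b E) u" using x by (simp add: N)
      then show ?thesis by (rule uc)
    qed
    then show ?thesis
      using ms' u m False by (intro exI[of _ "(u, c) # ms'"]) auto
  qed
qed

section \<open>Producing equally coloured neighbours of a vertex of degree 3\<close>

definition col_nbrs :: "'a set set \<Rightarrow> ('a \<Rightarrow> nat) \<Rightarrow> 'a \<Rightarrow> nat \<Rightarrow> 'a set" where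
  "col_nbrs E f v c = {u \<in> nbrs E v. f u = c}"

text \<open>With all four other colours present, each colour that is repeated among \<open>m\<close> neighbours
  contributes \<open>m \<le> 2 * (m - 1)\<close>.\<close>
lemma frozen_repeated_nbrs:
  assumes fin: "finite (nbrs E v)" and f: "f v \<in> {1..5}" "\<And>u. u \<in> nbrs E v \<Longrightarrow> f u \<in> {1..5} - {f v}"
    and frozen: "\<And>c. c \<in> {1..5} - {f v} \<Longrightarrow> col_nbrs E f v c \<noteq> {}"
  shows "card {u \<in> nbrs E v. col_nbrs E f v (f u) \<noteq> {u}} + 8 \<le> 2 * card (nbrs E v)"
proof -
  let ?C = "{1..5} - {f v}"
  define m where "m c = card (col_nbrs E f v c)" for c
  define r where "r c = card {u \<in> nbrs E v. f u = c \<and> col_nbrs E f v c \<noteq> {u}}" for c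
  have finC: "finite (col_nbrs E f v c)" for c using fin by (simp add: col_nbrs_def)
  have card_C: "card ?C = 4" using f(1) by simp
  have deg: "card (nbrs E v) = (\<Sum>c\<in>?C. m c)"
  proof -
    have "nbrs E v = (\<Union>c\<in>?C. col_nbrs E f v c)" using f(2) by (auto simp: col_nbrs_def)
    then have "card (nbrs E v) = card (\<Union>c\<in>?C. col_nbrs E f v c)" by simp
    also have "\<dots> = (\<Sum>c\<in>?C. m c)"
      unfolding m_def by (rule card_UN_disjoint) (use finC in \<open>auto simp: col_nbrs_def\<close>)
    finally show ?thesis .
  qed
  have rep: "card {u \<in> nbrs E v. col_nbrs E f v (f u) \<noteq> {u}} = (\<Sum>c\<in>?C. r c)"
  proof -
    have "{u \<in> nbrs E v. col_nbrs E f v (f u) \<noteq> {u}} =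
        (\<Union>c\<in>?C. {u \<in> nbrs E v. f u = c \<and> col_nbrs E f v c \<noteq> {u}})" using f(2) by auto
    then have "card {u \<in> nbrs E v. col_nbrs E f v (f u) \<noteq> {u}} =
        card (\<Union>c\<in>?C. {u \<in> nbrs E v. f u = c \<and> col_nbrs E f v c \<noteq> {u}})" by simp
    also have "\<dots> = (\<Sum>c\<in>?C. r c)"
      unfolding r_def by (rule card_UN_disjoint) (use fin in auto)
    finally show ?thesis .
  qed
  have "r c + 2 \<le> 2 * m c" if c: "c \<in> ?C" for c
  proof (cases "m c = 1")
    case True
    then obtain u where "col_nbrs E f v c = {u}" unfolding m_def by (meson card_1_singletonE)
    then have "{u \<in> nbrs E v. f u = c \<and> col_nbrs E f v c \<noteq> {u}} = {}" by (auto simp: col_nbrs_def)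
    then have "r c = 0" unfolding r_def by (simp only: card.empty)
    then show ?thesis using True by simp
  next
    case False
    have "m c \<noteq> 0" using frozen[OF c] finC by (simp add: m_def)
    moreover have "r c \<le> m c" unfolding r_def m_def by (intro card_mono finC) (auto simp: col_nbrs_def)
    ultimately show ?thesis using False by linarith
  qed
  then have "(\<Sum>c\<in>?C. r c + 2) \<le> (\<Sum>c\<in>?C. 2 * m c)" by (intro sum_mono)
  moreover have "(\<Sum>c\<in>?C. r c + 2) = (\<Sum>c\<in>?C. r c) + 8"
    unfolding sum.distrib sum_constant card_C by simp
  moreover have "(\<Sum>c\<in>?C. 2 * m c) = 2 * (\<Sum>c\<in>?C. m c)"
    by (rule sum_distrib_left[symmetric])
  ultimately show ?thesis unfolding rep deg by linarith
qed

lemma sum_degrees: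
  assumes G: "simple_graph V E"
  shows "(\<Sum>v\<in>V. card (nbrs E v)) = 2 * card E"
proof -
  note S = simple_graphD[OF G]
  have "card (nbrs E v) = card {e \<in> E. v \<in> e}" for v
  proof (rule bij_betw_same_card[of "\<lambda>u. {u, v}"], unfold bij_betw_def, intro conjI)
    show "inj_on (\<lambda>u. {u, v}) (nbrs E v)" by (auto simp: inj_on_def doubleton_eq_iff)
    show "(\<lambda>u. {u, v}) ` nbrs E v = {e \<in> E. v \<in> e}"
    proof (intro equalityI subsetI)
      fix e assume e: "e \<in> {e \<in> E. v \<in> e}"
      then have "card e = 2" using G by (auto simp: simple_graph_def)
      then obtain u where "e = {u, v}" using e by (auto simp: card_2_iff insert_commute)
      then show "e \<in> (\<lambda>u. {u, v}) ` nbrs E v" using e by (auto simp: nbrs_def)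
    qed (auto simp: nbrs_def)
  qed
  then have "(\<Sum>v\<in>V. card (nbrs E v)) = (\<Sum>v\<in>V. card {e \<in> E. v \<in> e})" by simp
  also have "\<dots> = (\<Sum>e\<in>E. card {v \<in> V. v \<in> e})"
    by (rule sum_multicount_gen[OF S(1,2)]) simp
  also have "\<dots> = (\<Sum>e\<in>E. 2)"
  proof (rule sum.cong[OF refl])
    fix e assume "e \<in> E"
    then have "{v \<in> V. v \<in> e} = e" "card e = 2" using G by (auto simp: simple_graph_def)
    then show "card {v \<in> V. v \<in> e} = 2" by simp
  qed
  finally show ?thesis by simp
qed

text \<open>A maximum independent subset dominates the rest of \<open>Q\<close>, and it is at least
  as large as each of the two independent sets that the sides cut out of \<open>Q\<close>.\<close>

lemma exists_large_independent_subset: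
  fixes side :: "'a \<Rightarrow> bool"
  assumes "finite Q" and side: "\<And>u v. u \<in> nbrs E v \<Longrightarrow> side u \<noteq> side v"
  shows "\<exists>Q0\<subseteq>Q. (\<forall>u\<in>Q0. \<forall>v\<in>Q0. u \<notin> nbrs E v) \<and>
    (\<forall>v\<in>Q - Q0. nbrs E v \<inter> Q0 \<noteq> {}) \<and> card Q \<le> 2 * card Q0"
proof -
  define indep where "indep A \<longleftrightarrow> A \<subseteq> Q \<and> (\<forall>u\<in>A. \<forall>v\<in>A. u \<notin> nbrs E v)" for A
  have "indep {}" by (simp add: indep_def)
  moreover have bound: "card A \<le> card Q" if "indep A" for A
    using that assms(1) by (auto simp: indep_def card_mono)
  ultimately have "\<exists>A. indep A \<and> (\<forall>B. indep B \<longrightarrow> card B \<le> card A)"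
    by (intro ex_has_greatest_nat[of indep "{}" card "Suc (card Q)"]) (auto simp: le_imp_less_Suc)
  then obtain Q0 where Q0: "indep Q0" and max: "\<And>A. indep A \<Longrightarrow> card A \<le> card Q0" by blast
  have fin: "finite Q0" using Q0 assms(1) by (auto simp: indep_def intro: finite_subset)
  show ?thesis
  proof (intro exI[of _ Q0] conjI ballI)
    show "Q0 \<subseteq> Q" "\<And>u v. u \<in> Q0 \<Longrightarrow> v \<in> Q0 \<Longrightarrow> u \<notin> nbrs E v" using Q0 by (auto simp: indep_def)
    show "nbrs E v \<inter> Q0 \<noteq> {}" if v: "v \<in> Q - Q0" for v
    proof
      assume disj: "nbrs E v \<inter> Q0 = {}"
      then have "u \<notin> nbrs E v \<and> v \<notin> nbrs E u" if "u \<in> Q0" for u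
        using that nbrs_sym[of v E u] by blast
      moreover have "v \<notin> nbrs E v" using side by blast
      ultimately have "indep (insert v Q0)"
        using Q0 v unfolding indep_def by auto
      from max[OF this] show False using v fin by simp
    qed
    have "indep {v \<in> Q. side v}" "indep {v \<in> Q. \<not> side v}" using side by (auto simp: indep_def)
    then have "card {v \<in> Q. side v} \<le> card Q0" "card {v \<in> Q. \<not> side v} \<le> card Q0" using max by auto
    moreover have "card Q = card {v \<in> Q. side v} + card {v \<in> Q. \<not> side v}"
      using assms(1) by (subst card_Un_disjoint[symmetric]) (auto intro: arg_cong[where f = card])
    ultimately show "card Q \<le> 2 * card Q0" by linarith
  qed
qed

text \<open>Here \<open>d\<close> is the degree, \<open>q\<close> the number of neighbours in
  \<open>Q0\<close>, \<open>T\<close> the neighbourhood of \<open>Q0\<close> and \<open>R\<close> a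
  set of frozen vertices. By sparsity, the excess \<open>x = d - 4\<close> has sum below |Q| over
  \<open>V - Q\<close>. By \<open>main\<close>, 3 |Q0| is at most the sum of \<open>x\<close> over
  \<open>T - R\<close> plus twice that over \<open>R\<close>. Vertices of \<open>Q - Q0\<close>
  contribute -1 each, all others count at most twice; so 3 |Q0| < 2 |Q| - (|Q| - |Q0|),
  contradicting \<open>half\<close>.\<close>

lemma discharging_contradiction:
  fixes d q :: "'a \<Rightarrow> int"
  assumes "finite V" "Q \<subseteq> V" "Q0 \<subseteq> Q" "T \<subseteq> V - Q0" "R \<subseteq> V - Q" "Q - Q0 \<subseteq> T"
    and d: "\<And>v. v \<in> V - Q \<Longrightarrow> 4 \<le> d v" "\<And>v. v \<in> Q \<Longrightarrow> d v = 3" and q: "\<And>v. 0 \<le> q v"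
    and sparse: "(\<Sum>v\<in>V. d v) < 4 * int (card V)" and half: "card Q \<le> 2 * card Q0"
    and q_sum: "3 * int (card Q0) \<le> (\<Sum>v\<in>T \<union> R. q v)"
    and main: "(\<Sum>t\<in>T - R. 4 - d t + q t) \<le> (\<Sum>s\<in>R. 2 * (d s - q s - 4))"
  shows False
proof -
  define x where "x v = d v - 4" for v
  have fin: "finite T" "finite R" "finite Q" "finite Q0" "finite (V - Q)"
    using assms(1-5) by (auto intro: finite_subset)
  have "(\<Sum>t\<in>T - R. q t) + 2 * (\<Sum>s\<in>R. q s) \<le> (\<Sum>t\<in>T - R. x t) + 2 * (\<Sum>s\<in>R. x s)"
  proof -
    have "(\<Sum>t\<in>T - R. 4 - d t + q t) = (\<Sum>t\<in>T - R. q t) - (\<Sum>t\<in>T - R. x t)"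
      unfolding x_def sum_subtractf[symmetric] by (rule sum.cong) auto
    moreover have "(\<Sum>s\<in>R. 2 * (d s - q s - 4)) = 2 * (\<Sum>s\<in>R. x s) - 2 * (\<Sum>s\<in>R. q s)"
      unfolding x_def sum_distrib_left sum_subtractf[symmetric] by (rule sum.cong) auto
    ultimately show ?thesis using main by linarith
  qed
  moreover have "(\<Sum>v\<in>T \<union> R. q v) = (\<Sum>t\<in>T - R. q t) + (\<Sum>s\<in>R. q s)"
    using fin by (subst sum.union_disjoint[symmetric]) (auto intro!: sum.cong)
  moreover have "0 \<le> (\<Sum>s\<in>R. q s)" using q by (simp add: sum_nonneg)
  ultimately have low: "3 * int (card Q0) \<le> (\<Sum>t\<in>T - R. x t) + 2 * (\<Sum>s\<in>R. x s)"
    using q_sum by linarith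
  let ?T = "T - R - Q"
  have "T - R = ?T \<union> (Q - Q0)" "?T \<inter> (Q - Q0) = {}" using assms(3-6) by auto
  then have "(\<Sum>t\<in>T - R. x t) = (\<Sum>t\<in>?T. x t) + (\<Sum>t\<in>Q - Q0. x t)"
    using fin by (metis finite_Diff sum.union_disjoint)
  moreover have "(\<Sum>t\<in>Q - Q0. x t) = - (int (card Q) - int (card Q0))"
  proof -
    have "(\<Sum>t\<in>Q - Q0. x t) = (\<Sum>t\<in>Q - Q0. - 1)" using d(2) by (intro sum.cong) (auto simp: x_def)
    also have "\<dots> = - int (card (Q - Q0))" by simp
    finally show ?thesis
      using assms(3) fin by (simp add: card_Diff_subset of_nat_diff card_mono)
  qed
  moreover have "(\<Sum>t\<in>?T. x t) + (\<Sum>s\<in>R. x s) \<le> (\<Sum>v\<in>V - Q. x v)"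
  proof -
    have "(\<Sum>t\<in>?T. x t) + (\<Sum>s\<in>R. x s) = (\<Sum>v\<in>?T \<union> R. x v)"
      using fin by (subst sum.union_disjoint) auto
    also have "\<dots> \<le> (\<Sum>v\<in>V - Q. x v)"
      using fin assms(4,5) d(1) by (intro sum_mono2) (auto simp: x_def)
    finally show ?thesis .
  qed
  moreover have "0 \<le> (\<Sum>t\<in>?T. x t)" using assms(4) d(1) by (intro sum_nonneg) (auto simp: x_def)
  moreover have "(\<Sum>v\<in>V - Q. x v) < int (card Q)"
  proof -
    have "(\<Sum>v\<in>V. x v) = (\<Sum>v\<in>V. d v) - 4 * int (card V)"
      by (simp add: x_def sum_subtractf)
    moreover have "(\<Sum>v\<in>V. x v) = (\<Sum>v\<in>V - Q. x v) + (\<Sum>v\<in>Q. x v)"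
      using assms(1,2) by (simp add: sum.subset_diff)
    moreover have "(\<Sum>v\<in>Q. x v) = - int (card Q)"
    proof -
      have "(\<Sum>v\<in>Q. x v) = (\<Sum>v\<in>Q. - 1)" using d(2) by (intro sum.cong) (auto simp: x_def)
      then show ?thesis by simp
    qed
    ultimately show ?thesis using sparse by linarith
  qed
  ultimately show False using low half by linarith
qed

text \<open>Call a vertex frozen if all four other colours occur among its neighbours outside
  \<open>Q0\<close>. If no short sequence succeeds, every linked pair (t, s) has \<open>s\<close>
  frozen, and either \<open>t\<close> is frozen too or its colour is repeated around
  \<open>s\<close>. A frozen vertex has few repeated neighbours compared with its degree, so
  counting links contradicts sparsity. Two moves per vertex are what the induction can
  afford.\<close>

lemma exists_mergeable:
  fixes V :: "'a set" and side :: "'a \<Rightarrow> bool"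
  assumes G: "simple_graph V E" and side: "\<And>u v. u \<in> nbrs E v \<Longrightarrow> side u \<noteq> side v"
    and sparse: "card E < 2 * card V" and deg: "\<And>v. v \<in> V \<Longrightarrow> 3 \<le> card (nbrs E v)"
    and f: "proper V E f"
  shows "\<exists>ms w a b. legal V E f ms \<and> (\<forall>v. moves ms {v} \<le> 2) \<and> w \<in> V \<and> card (nbrs E w) = 3 \<and>
    a \<in> nbrs E w \<and> b \<in> nbrs E w \<and> a \<noteq> b \<and> run f ms a = run f ms b"
proof (rule ccontr)
  assume no: "\<not> ?thesis"
  note no' = no[unfolded not_ex, THEN spec, THEN spec, THEN spec, THEN spec]
  note S = simple_graphD[OF G]
  define Q where "Q = {v \<in> V. card (nbrs E v) = 3}"
  have finQ: "finite Q" using S(1) by (simp add: Q_def)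
  have "\<exists>Q0\<subseteq>Q. (\<forall>u\<in>Q0. \<forall>v\<in>Q0. u \<notin> nbrs E v) \<and>
      (\<forall>v\<in>Q - Q0. nbrs E v \<inter> Q0 \<noteq> {}) \<and> card Q \<le> 2 * card Q0"
    by (rule exists_large_independent_subset[OF finQ, of E side]) (rule side)
  then obtain Q0 where "Q0 \<subseteq> Q \<and> (\<forall>u\<in>Q0. \<forall>v\<in>Q0. u \<notin> nbrs E v) \<and>
      (\<forall>v\<in>Q - Q0. nbrs E v \<inter> Q0 \<noteq> {}) \<and> card Q \<le> 2 * card Q0"
    by (rule exE)
  then have Q0: "Q0 \<subseteq> Q" "\<And>u v. u \<in> Q0 \<Longrightarrow> v \<in> Q0 \<Longrightarrow> u \<notin> nbrs E v"
      "\<And>v. v \<in> Q - Q0 \<Longrightarrow> nbrs E v \<inter> Q0 \<noteq> {}" "card Q \<le> 2 * card Q0"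
    by simp_all
  have Q0V: "Q0 \<subseteq> V" using Q0(1) by (auto simp: Q_def)
  have Q0_deg: "card (nbrs E w) = 3" if "w \<in> Q0" for w using Q0(1) that by (auto simp: Q_def)
  have Q0_nbr: "t \<in> V - Q0" if "t \<in> nbrs E w" "w \<in> Q0" for t w
    using that Q0(2) S(3) by blast
  define E' where "E' = del_verts Q0 E"
  have nbrs': "nbrs E' v = nbrs E v - Q0" if "v \<notin> Q0" for v
    unfolding E'_def using that by (rule nbrs_del_verts)
  note S' = simple_graphD[OF simple_graph_del_verts[OF G, of Q0], folded E'_def]
  have sub': "nbrs E' v \<subseteq> nbrs E v" for v by (auto simp: E'_def nbrs_def del_verts_def)
  have side': "side u \<noteq> side v" if "u \<in> nbrs E' v" for u v using that sub' side by blast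
  have f_in: "f v \<in> {1..5}" if "v \<in> V" for v using f that by (simp add: proper_def)
  have f_ne: "f u \<noteq> f v" if "u \<in> nbrs E v" for u v using f that by (simp add: proper_def)
  have rainbow: "f a \<noteq> f b" if "w \<in> Q0" "a \<in> nbrs E w" "b \<in> nbrs E w" "a \<noteq> b" for w a b
  proof
    assume "f a = f b"
    then have "legal V E f [] \<and> (\<forall>v. moves [] {v} \<le> 2) \<and> w \<in> V \<and> card (nbrs E w) = 3 \<and>
      a \<in> nbrs E w \<and> b \<in> nbrs E w \<and> a \<noteq> b \<and> run f [] a = run f [] b"
      using that Q0V Q0_deg by auto
    then show False by (rule notE[OF no', rotated])
  qed
  \<comment> \<open>In the lifted sequence a vertex of \<open>Q0\<close> moves at most as often as
    its neighbours together; this is why their moves, too, are bounded by 2.\<close>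
  have fail: False
    if legal: "legal (V - Q0) E' f ms" and le2: "\<And>v. moves ms {v} \<le> 2" "\<And>w. w \<in> Q0 \<Longrightarrow> moves ms (nbrs E w) \<le> 2"
      and w: "w \<in> Q0" "a \<in> nbrs E w" "b \<in> nbrs E w" "a \<noteq> b" and eq: "run f ms a = run f ms b" for ms w a b
  proof -
    obtain ms' where ms': "legal V E f ms'"
      "\<And>u. u \<notin> Q0 \<Longrightarrow> run f ms' u = run f ms u \<and> moves ms' {u} = moves ms {u}"
      "\<And>w. w \<in> Q0 \<Longrightarrow> moves ms' {w} \<le> moves ms (nbrs E w)"
      using lift_moves_over_independent_set[OF G Q0V, of f ms] Q0(2) Q0_deg f legal
      unfolding E'_def by auto
    have "\<forall>v. moves ms' {v} \<le> 2"
    proof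
      fix v show "moves ms' {v} \<le> 2" using ms'(2,3)[of v] le2[of v] by (cases "v \<in> Q0") auto
    qed
    moreover have "run f ms' a = run f ms' b"
      using ms'(2) Q0_nbr[OF w(2,1)] Q0_nbr[OF w(3,1)] eq by simp
    ultimately have "legal V E f ms' \<and> (\<forall>v. moves ms' {v} \<le> 2) \<and> w \<in> V \<and> card (nbrs E w) = 3 \<and>
      a \<in> nbrs E w \<and> b \<in> nbrs E w \<and> a \<noteq> b \<and> run f ms' a = run f ms' b"
      using ms'(1) w Q0V Q0_deg[OF w(1)] by (simp add: subsetD)
    then show False by (rule notE[OF no', rotated])
  qed

  text \<open>The pair (\<open>t\<close>, \<open>s\<close>) is linked if moving \<open>s\<close> away would let \<open>t\<close> take the
    colour of another neighbour of some \<open>w \<in> Q0\<close>.\<close>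
  define link where "link t s \<longleftrightarrow> (\<exists>w\<in>Q0. \<exists>b. t \<in> nbrs E w \<and> b \<in> nbrs E w \<and> b \<noteq> t \<and>
    col_nbrs E' f t (f b) = {s})" for t s
  have linkD: "s \<in> nbrs E' t" "t \<in> nbrs E' s" "t \<in> V - Q0" "s \<in> V - Q0" if l: "link t s" for t s
  proof -
    obtain w b where "w \<in> Q0" "t \<in> nbrs E w" "col_nbrs E' f t (f b) = {s}"
      using l unfolding link_def by blast
    then show "t \<in> V - Q0" and s: "s \<in> nbrs E' t" using Q0_nbr by (auto simp: col_nbrs_def)
    then show "t \<in> nbrs E' s" "s \<in> V - Q0" using nbrs_sym[of t E' s] S'(3) by auto
  qed
  \<comment> \<open>If the colour of \<open>b\<close> were absent around \<open>t\<close>, a single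
    move of \<open>t\<close> would make \<open>t\<close> and \<open>b\<close> equal.\<close>
  have present: "col_nbrs E' f t (f b) \<noteq> {}"
    if w: "w \<in> Q0" "t \<in> nbrs E w" "b \<in> nbrs E w" "b \<noteq> t" for t w b
  proof
    assume empty: "col_nbrs E' f t (f b) = {}"
    let ?ms = "[(t, f b)]"
    have "t \<in> V - Q0" "b \<in> V - Q0" using w Q0_nbr by blast+
    moreover have "\<forall>u\<in>nbrs E' t. f u \<noteq> f b" using empty by (auto simp: col_nbrs_def)
    ultimately have "legal (V - Q0) E' f ?ms" using f_in by simp
    then show False by (rule fail[OF _ _ _ w(1,2,3)]) (use w(4) in auto)
  qed
  have missing: "\<exists>c\<in>{1..5}. c \<noteq> f v \<and> (\<forall>u\<in>nbrs E' v. f u \<noteq> c)"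
    if "\<not> (\<forall>c\<in>{1..5} - {f v}. col_nbrs E' f v c \<noteq> {})" for v
    using that by (auto simp: col_nbrs_def)
  \<comment> \<open>Otherwise \<open>s\<close> steps aside and \<open>t\<close> takes the colour of
    \<open>b\<close>. The sides ensure that \<open>s\<close> is not \<open>b\<close>, which must
    keep its colour.\<close>
  have frozen_s: "\<forall>c\<in>{1..5} - {f s}. col_nbrs E' f s c \<noteq> {}" if l: "link t s" for t s
  proof (rule ccontr)
    assume "\<not> ?thesis"
    then obtain c where c: "c \<in> {1..5}" "c \<noteq> f s" "\<forall>u\<in>nbrs E' s. f u \<noteq> c" using missing by blast
    obtain w b where w: "w \<in> Q0" "t \<in> nbrs E w" "b \<in> nbrs E w" "b \<noteq> t" and s: "col_nbrs E' f t (f b) = {s}"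
      using l unfolding link_def by blast
    have fs: "f s = f b" and uniq: "\<And>u. u \<in> nbrs E' t \<Longrightarrow> f u = f b \<Longrightarrow> u = s"
      using s by (auto simp: col_nbrs_def)
    have "side s \<noteq> side t" "side t \<noteq> side w" "side b \<noteq> side w"
      using side'[OF linkD(1)[OF l]] side w by blast+
    then have ne: "s \<noteq> b" "s \<noteq> t" by auto
    let ?ms = "[(s, c), (t, f b)]"
    have "b \<in> V" using w(3) S(3) by blast
    then have "legal (V - Q0) E' f ?ms" using linkD(3,4)[OF l] c fs uniq f_in by auto
    then show False
      by (rule fail[OF _ _ _ w(1,2,3)]) (use w(4) ne in auto)
  qed
  \<comment> \<open>Otherwise three moves succeed: \<open>t\<close> goes to a spare colour,
    \<open>s\<close> takes the old colour of \<open>t\<close>, which no other neighbour of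
    \<open>s\<close> has, and \<open>t\<close> takes the colour that \<open>s\<close> gave
    up.\<close>
  have frozen_t: "\<forall>c\<in>{1..5} - {f t}. col_nbrs E' f t c \<noteq> {}"
    if l: "link t s" and t: "col_nbrs E' f s (f t) = {t}" for t s
  proof (rule ccontr)
    assume "\<not> ?thesis"
    then obtain c where c: "c \<in> {1..5}" "c \<noteq> f t" "\<forall>u\<in>nbrs E' t. f u \<noteq> c" using missing by blast
    obtain w b where w: "w \<in> Q0" "t \<in> nbrs E w" "b \<in> nbrs E w" "b \<noteq> t" and s: "col_nbrs E' f t (f b) = {s}"
      using l unfolding link_def by blast
    have fs: "f s = f b" and uniq: "\<And>u. u \<in> nbrs E' t \<Longrightarrow> f u = f b \<Longrightarrow> u = s"
      using s by (auto simp: col_nbrs_def)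
    have uniq_t: "\<And>u. u \<in> nbrs E' s \<Longrightarrow> f u = f t \<Longrightarrow> u = t"
      using t by (auto simp: col_nbrs_def)
    have sides: "side s \<noteq> side t" "side t \<noteq> side w" "side b \<noteq> side w"
      using side'[OF linkD(1)[OF l]] side w by blast+
    then have ne: "s \<noteq> b" "s \<noteq> t" by auto
    have "f t \<noteq> f b" using rainbow[OF w(1,2,3)] w(4) by auto
    let ?ms = "[(t, c), (s, f t), (t, f b)]"
    have bt: "b \<in> V" "t \<in> V" using w(2,3) S(3) by blast+
    have not_self: "s \<notin> nbrs E' s" "t \<notin> nbrs E' t" using S'(5) by auto
    have leg: "legal (V - Q0) E' f ?ms"
      using linkD(3,4)[OF l] c fs uniq uniq_t f_in[OF bt(1)] f_in[OF bt(2)] \<open>f t \<noteq> f b\<close> ne not_self by auto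
    \<comment> \<open>As \<open>s\<close> and \<open>t\<close> lie on different sides, no
      \<open>w'\<close> is adjacent to both; its neighbours make the two moves of \<open>t\<close>
      or the one of \<open>s\<close> at most.\<close>
    have bound: "moves ?ms (nbrs E w') \<le> 2" for w'
      using side[of t w'] side[of s w'] sides(1) by auto
    show False
      by (rule fail[OF leg _ bound w(1,2,3)]) (use w(4) ne in auto)
  qed
  define T where "T = {t \<in> V - Q0. nbrs E t \<inter> Q0 \<noteq> {}}"
  \<comment> \<open>All vertices of \<open>R\<close> are frozen. If \<open>t\<close> is linked to
    \<open>s\<close> and lies outside \<open>R\<close>, its colour is repeated around
    \<open>s\<close>, so \<open>t\<close> is in \<open>rep s\<close>.\<close>
  define R where "R = {s. \<exists>t. link t s} \<union> {t. \<exists>s. link t s \<and> col_nbrs E' f s (f t) = {t}}"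
  define rep where "rep s = {u \<in> nbrs E' s. col_nbrs E' f s (f u) \<noteq> {u}}" for s
  define q where "q v = card (nbrs E v \<inter> Q0)" for v
  have R_V: "R \<subseteq> V - Q0" using linkD(3,4) by (auto simp: R_def)
  then have finR: "finite R" using S(1) by (meson finite_Diff finite_subset)
  have finT: "finite T" using S(1) by (simp add: T_def)
  have deg': "card (nbrs E v) = card (nbrs E' v) + q v" if "v \<notin> Q0" for v
    unfolding q_def nbrs'[OF that] using card_Int_Diff[OF S(7)[of v], of Q0] by simp
  have rep_card: "card (rep s) + 8 \<le> 2 * card (nbrs E' s)" if "s \<in> R" for s
  proof -
    have "s \<in> V" "s \<notin> Q0" using R_V that by auto
    have "\<forall>c\<in>{1..5} - {f s}. col_nbrs E' f s c \<noteq> {}"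
      using that frozen_s frozen_t unfolding R_def by blast
    then show ?thesis
      unfolding rep_def using S'(7) f_in f_ne \<open>s \<in> V\<close> sub' S'(3)
      by (intro frozen_repeated_nbrs) blast+
  qed
  define L where "L t = {s. link t s}" for t
  have L_fin: "finite (L t)" for t
    by (rule finite_subset[OF _ S'(7)[of t]]) (use linkD(1) in \<open>auto simp: L_def\<close>)
  \<comment> \<open>The colours of the two other neighbours of some \<open>w\<close> in
    \<open>Q0\<close> both occur around \<open>t\<close>, either twice or once with a link. They are
    distinct, so the contributions add up to 4.\<close>
  have L_card: "4 \<le> card (L t) + card (nbrs E' t)" if "t \<in> T" for t
  proof -
    have "nbrs E t \<inter> Q0 \<noteq> {}" using that by (simp add: T_def)
    then obtain w where w: "w \<in> Q0" "t \<in> nbrs E w" using nbrs_sym[of _ E t] by blast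
    have "card (nbrs E w - {t}) = 2" using Q0_deg[OF w(1)] w(2) S(7)[of w] by simp
    then obtain a b where ab: "nbrs E w - {t} = {a, b}" "a \<noteq> b" by (meson card_2_iff)
    then have abw: "a \<in> nbrs E w" "b \<in> nbrs E w" "a \<noteq> t" "b \<noteq> t" by auto
    have "f a \<noteq> f b" using rainbow w(1) abw ab(2) by blast
    define C where "C x = col_nbrs E' f t (f x)" for x
    define D where "D x = (if card (C x) = 1 then C x else {})" for x
    have finC: "finite (C x)" for x using S'(7) by (simp add: C_def col_nbrs_def)
    have C_ne: "C a \<noteq> {}" "C b \<noteq> {}" unfolding C_def using present[OF w] abw by auto
    have CD: "2 \<le> card (C x) + card (D x)" if "C x \<noteq> {}" for x
    proof -
      have "0 < card (C x)" using that finC by (simp add: card_gt_0_iff)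
      then show ?thesis by (auto simp: D_def)
    qed
    have D_sub: "D x \<subseteq> L t" if x: "x \<in> nbrs E w" "x \<noteq> t" for x
    proof (cases "card (C x) = 1")
      case True
      then obtain s where "C x = {s}" by (meson card_1_singletonE)
      then have "link t s" unfolding link_def C_def using w x by blast
      then show ?thesis using \<open>C x = {s}\<close> by (auto simp: D_def L_def)
    qed (simp add: D_def)
    have disj: "C a \<inter> C b = {}" using \<open>f a \<noteq> f b\<close> by (auto simp: C_def col_nbrs_def)
    then have "D a \<inter> D b = {}" by (auto simp: D_def)
    moreover have "finite (D x)" for x using finC by (simp add: D_def)
    ultimately have "card (D a) + card (D b) \<le> card (L t)"
      using D_sub[of a] D_sub[of b] abw card_mono[OF L_fin, of "D a \<union> D b" t] by (simp add: card_Un_disjoint)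
    moreover have "card (C a) + card (C b) \<le> card (nbrs E' t)"
      using disj finC card_mono[OF S'(7)[of t], of "C a \<union> C b"]
      by (simp add: card_Un_disjoint C_def col_nbrs_def)
    ultimately show ?thesis using CD[OF C_ne(1)] CD[OF C_ne(2)] by linarith
  qed
  \<comment> \<open>Links are counted from both ends: seen from \<open>s\<close>, a link from
    outside \<open>R\<close> is a repeated neighbour.\<close>
  have "(\<Sum>t\<in>T - R. card (L t)) \<le> (\<Sum>s\<in>R. card (rep s))"
  proof -
    have "(\<Sum>t\<in>T - R. card (L t)) = card (SIGMA t:T - R. L t)"
      using finT L_fin by simp
    also have "\<dots> \<le> card (SIGMA s:R. rep s)"
    proof (rule card_inj_on_le[of prod.swap])
      show "prod.swap ` (SIGMA t:T - R. L t) \<subseteq> (SIGMA s:R. rep s)"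
        using linkD(2) by (auto simp: L_def R_def rep_def)
      show "finite (SIGMA s:R. rep s)" using finR S'(7) by (auto simp: rep_def)
    qed auto
    also have "\<dots> = (\<Sum>s\<in>R. card (rep s))"
      using finR S'(7) by (simp add: rep_def)
    finally show ?thesis .
  qed
  then have "int (\<Sum>t\<in>T - R. card (L t)) \<le> int (\<Sum>s\<in>R. card (rep s))" by (rule zle_int[THEN iffD2])
  moreover have "(\<Sum>t\<in>T - R. 4 - int (card (nbrs E t)) + int (q t)) \<le> int (\<Sum>t\<in>T - R. card (L t))"
    unfolding of_nat_sum
  proof (rule sum_mono)
    fix t assume t: "t \<in> T - R"
    then have "t \<notin> Q0" by (simp add: T_def)
    then show "4 - int (card (nbrs E t)) + int (q t) \<le> int (card (L t))"
      using L_card[of t] deg'[of t] t by simp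
  qed
  moreover have "int (\<Sum>s\<in>R. card (rep s)) \<le> (\<Sum>s\<in>R. 2 * (int (card (nbrs E s)) - int (q s) - 4))"
    unfolding of_nat_sum
  proof (rule sum_mono)
    fix s assume s: "s \<in> R"
    then have "s \<notin> Q0" using R_V by auto
    then show "int (card (rep s)) \<le> 2 * (int (card (nbrs E s)) - int (q s) - 4)"
      using rep_card[OF s] deg'[of s] by simp
  qed
  ultimately have main: "(\<Sum>t\<in>T - R. 4 - int (card (nbrs E t)) + int (q t)) \<le>
      (\<Sum>s\<in>R. 2 * (int (card (nbrs E s)) - int (q s) - 4))" by linarith
  \<comment> \<open>All edges at \<open>Q0\<close> lead into \<open>T\<close>, three from each
    vertex of \<open>Q0\<close>.\<close>
  have "(\<Sum>v\<in>T \<union> R. q v) = 3 * card Q0"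
  proof -
    have "(\<Sum>v\<in>T \<union> R. q v) = (\<Sum>v\<in>V. q v)"
    proof (rule sum.mono_neutral_left[OF S(1)])
      show "T \<union> R \<subseteq> V" using R_V by (auto simp: T_def)
      show "\<forall>v\<in>V - (T \<union> R). q v = 0"
      proof
        fix v assume v: "v \<in> V - (T \<union> R)"
        have "nbrs E v \<inter> Q0 = {}"
        proof (cases "v \<in> Q0")
          case True
          then show ?thesis using Q0(2) by blast
        qed (use v in \<open>auto simp: T_def\<close>)
        then show "q v = 0" by (simp add: q_def)
      qed
    qed
    also have "\<dots> = (\<Sum>v\<in>V. card {w \<in> Q0. v \<in> nbrs E w})"
    proof (rule sum.cong[OF refl])
      fix v
      have "nbrs E v \<inter> Q0 = {w \<in> Q0. v \<in> nbrs E w}" using nbrs_sym[of v E] by blast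
      then show "q v = card {w \<in> Q0. v \<in> nbrs E w}" by (simp add: q_def)
    qed
    also have "\<dots> = (\<Sum>w\<in>Q0. 3)"
    proof (rule sum_multicount_gen[OF S(1) finite_subset[OF Q0V S(1)]], rule ballI)
      fix w assume "w \<in> Q0"
      have "{v \<in> V. v \<in> nbrs E w} = nbrs E w" using S(6) by blast
      then show "card {v \<in> V. v \<in> nbrs E w} = 3" using Q0_deg[OF \<open>w \<in> Q0\<close>] by simp
    qed
    finally show ?thesis by simp
  qed
  then have q_sum: "3 * int (card Q0) \<le> (\<Sum>v\<in>T \<union> R. int (q v))"
    by (simp flip: of_nat_sum)
  have degs: "(\<Sum>v\<in>V. int (card (nbrs E v))) < 4 * int (card V)"
  proof -
    have "(\<Sum>v\<in>V. int (card (nbrs E v))) = int (\<Sum>v\<in>V. card (nbrs E v))" by simp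
    also have "\<dots> = 2 * int (card E)" unfolding sum_degrees[OF G] by simp
    finally show ?thesis using sparse by linarith
  qed
  \<comment> \<open>A frozen vertex sees four colours and so has degree at least 4.\<close>
  have R_Q: "R \<subseteq> V - Q"
  proof
    fix s assume s: "s \<in> R"
    then have "s \<in> V" "s \<notin> Q0" using R_V by auto
    moreover have "4 \<le> card (nbrs E s)" using rep_card[OF s] deg'[OF \<open>s \<notin> Q0\<close>] by linarith
    ultimately show "s \<in> V - Q" by (simp add: Q_def)
  qed
  show False
  proof (rule discharging_contradiction[OF S(1) _ Q0(1) _ R_Q _ _ _ _ degs Q0(4) q_sum main])
    show "Q - Q0 \<subseteq> T" using Q0(3) by (auto simp: T_def Q_def)
    show "4 \<le> int (card (nbrs E v))" if "v \<in> V - Q" for v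
      using deg[of v] that by (auto simp: Q_def)
  qed (auto simp: Q_def T_def)
qed

section \<open>The recolouring theorem\<close>

text \<open>Two contractions realise the identification: \<open>w\<close> into \<open>a\<close>,
  which makes \<open>a\<close> and \<open>b\<close> adjacent, then \<open>b\<close> into
  \<open>a\<close>. Of the edges at \<open>w\<close> only two are kept beforehand, so the first
  contraction contributes just the edge \<open>{a, b}\<close>.\<close>

lemma blob_planar_identify:
  assumes G: "simple_graph V E" and "blob_planar V E"
    and ab: "a \<in> nbrs E w" "b \<in> nbrs E w" "a \<noteq> b"
  shows "blob_planar (V - {b} - {w}) (del_verts {w} (absorb a b E))"
proof -
  have two: "card e = 2" "e \<subseteq> V" if "e \<in> E" for e using G that by (auto simp: simple_graph_def)
  have edges: "{a, w} \<in> E" "{b, w} \<in> E" using ab by (auto simp: nbrs_def)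
  have ne: "a \<noteq> w" "b \<noteq> w" using simple_graphD(5)[OF G] ab by auto
  define E1 where "E1 = {e \<in> E. w \<notin> e} \<union> {{a, w}, {b, w}}"
  have "E1 \<subseteq> E" using edges by (auto simp: E1_def)
  then have "blob_planar V E1" using blob_planar_subgraph[OF assms(2), of V E1] two by blast
  define E2 where "E2 = absorb a w E1"
  have "blob_planar (V - {w}) E2"
    unfolding E2_def
    by (rule blob_planar_absorb[OF \<open>blob_planar V E1\<close>]) (use two \<open>E1 \<subseteq> E\<close> in \<open>auto simp: E1_def\<close>)
  moreover have "{a, b} \<in> E2" using ab(3) by (auto simp: E2_def absorb_def E1_def insert_commute)
  moreover have "card e = 2" if "e \<in> E2" for e
    using that two \<open>E1 \<subseteq> E\<close> by (auto simp: E2_def absorb_def)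
  ultimately have "blob_planar (V - {w} - {b}) (absorb a b E2)" by (rule blob_planar_absorb)
  moreover have "V - {w} - {b} = V - {b} - {w}" by blast
  ultimately have bp: "blob_planar (V - {b} - {w}) (absorb a b E2)" by simp
  have E2I: "e \<in> E2" if "e \<in> E" "w \<notin> e" for e using that by (auto simp: E2_def absorb_def E1_def)
  have sub: "del_verts {w} (absorb a b E) \<subseteq> absorb a b E2"
  proof
    fix e assume "e \<in> del_verts {w} (absorb a b E)"
    then have e: "e \<in> absorb a b E" "w \<notin> e" by (auto simp: del_verts_def)
    then consider "e \<in> E" "b \<notin> e" | z where "e = {a, z}" "{b, z} \<in> E" "z \<noteq> a"
      unfolding absorb_def by blast
    then show "e \<in> absorb a b E2"
    proof cases
      case 1
      then show ?thesis using E2I e(2) by (auto simp: absorb_def)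
    next
      case 2
      then have "{b, z} \<in> E2" using E2I e(2) ne by auto
      then show ?thesis using 2 by (auto simp: absorb_def)
    qed
  qed
  have "e \<subseteq> V - {b} - {w}" if "e \<in> del_verts {w} (absorb a b E)" for e
  proof -
    have e: "e \<in> absorb a b E" "w \<notin> e" using that by (auto simp: del_verts_def)
    then consider "e \<in> E" "b \<notin> e" | z where "e = {a, z}" "{b, z} \<in> E" "z \<noteq> a"
      unfolding absorb_def by blast
    then show ?thesis
    proof cases
      case 1
      then show ?thesis using two(2) e(2) by auto
    next
      case 2
      then show ?thesis using two[OF 2(2)] two(2)[OF edges(1)] e(2) ab(3) by auto
    qed
  qed
  with blob_planar_subgraph[OF bp order_refl sub] show ?thesis by blast
qed

lemma simple_graph_absorb:
  assumes "simple_graph V E" "a \<noteq> b" "{a, b} \<notin> E" "a \<in> V"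
  shows "simple_graph (V - {b}) (absorb a b E)"
proof -
  have "{b, a} \<notin> E" using assms(3) by (simp add: insert_commute)
  then show ?thesis
    using assms by (auto simp: simple_graph_def absorb_def card_insert_if)
qed

text \<open>At most two neighbours move at most \<open>2 * B\<close> times together, so
  \<open>v\<close> follows in at most \<open>(2 * B + 1) div 2 = B\<close> moves. In the end its
  neighbours have the colour of the other side, and one more move settles \<open>v\<close>.\<close>

lemma extend_over_low_degree_vertex:
  fixes V :: "'a set" and side :: "'a \<Rightarrow> bool"
  assumes G: "simple_graph V E" and side: "\<And>u v. u \<in> nbrs E v \<Longrightarrow> side u \<noteq> side v"
    and v: "v \<in> V" "card (nbrs E v) \<le> 2" and f: "proper V E f"
    and leg: "legal (V - {v}) (del_verts {v} E) f ms" and B: "\<And>u. moves ms {u} \<le> B"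
    and canon: "\<And>u. u \<in> V - {v} \<Longrightarrow> run f ms u = (if side u then 1 else 2)"
  shows "\<exists>ms'. legal V E f ms' \<and> (\<forall>u. moves ms' {u} \<le> B + 1) \<and>
    (\<forall>u\<in>V. run f ms' u = (if side u then 1 else 2))"
proof -
  note S = simple_graphD[OF G]
  obtain ms' where ms': "legal V E f ms'"
    "\<And>u. u \<noteq> v \<Longrightarrow> run f ms' u = run f ms u \<and> moves ms' {u} = moves ms {u}"
    "moves ms' {v} \<le> (moves ms (nbrs E v) + 1) div 2"
    using lift_moves_over_vertex[OF G v f leg] by blast
  have "moves ms (nbrs E v) = (\<Sum>u\<in>nbrs E v. moves ms {u})" by (rule moves_eq_sum[OF S(7)])
  also have "\<dots> \<le> card (nbrs E v) * B"
    using sum_bounded_above[of "nbrs E v" "\<lambda>u. moves ms {u}" B] B by simp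
  also have "\<dots> \<le> 2 * B" using v(2) by simp
  finally have v_moves: "moves ms' {v} \<le> B" using ms'(3) by linarith
  let ?c = "if side v then 1 else 2 :: nat"
  have "run f ms' u \<noteq> ?c" if "u \<in> nbrs E v" for u
  proof -
    have "u \<in> V - {v}" using that S(3,5) by blast
    then show ?thesis using canon[of u] ms'(2)[of u] side[OF that] by auto
  qed
  then have "legal V E f (ms' @ [(v, ?c)])" using ms'(1) v(1) by auto
  moreover have "moves (ms' @ [(v, ?c)]) {u} \<le> B + 1" for u
    using v_moves ms'(2)[of u] B[of u] by (cases "u = v") auto
  moreover have "run f (ms' @ [(v, ?c)]) u = (if side u then 1 else 2)" if "u \<in> V" for u
    using canon[of u] ms'(2)[of u] that by (cases "u = v") auto
  ultimately show ?thesis by blast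
qed

text \<open>The target depends only on \<open>side\<close>, which the smaller graphs inherit, so the
  induction hypothesis ends at the restriction of the same target.\<close>

theorem recolour_to_side_colouring:
  fixes V :: "'a set" and side :: "'a \<Rightarrow> bool"
  assumes "simple_graph V E" "blob_planar V E" "\<And>u v. u \<in> nbrs E v \<Longrightarrow> side u \<noteq> side v" "proper V E f"
  shows "\<exists>ms. legal V E f ms \<and> (\<forall>v. moves ms {v} \<le> 2 * card V) \<and>
    (\<forall>v\<in>V. run f ms v = (if side v then 1 else 2))"
  using assms
proof (induction "card V" arbitrary: V E f rule: less_induct)
  case less
  note G = less.prems(1) and side = less.prems(3) and f = less.prems(4)
  note S = simple_graphD[OF G]
  show ?case
  proof (cases "\<exists>v\<in>V. card (nbrs E v) \<le> 2")
    case True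
    then obtain v where v: "v \<in> V" "card (nbrs E v) \<le> 2" by blast
    have card: "card V = Suc (card (V - {v}))" using v(1) S(1) by (metis card_Suc_Diff1)
    have bp: "blob_planar (V - {v}) (del_verts {v} E)"
      by (rule blob_planar_subgraph[OF less.prems(2)])
         (use G in \<open>auto simp: simple_graph_def del_verts_def\<close>)
    have side': "side u \<noteq> side w" if "u \<in> nbrs (del_verts {v} E) w" for u w
      using that by (intro side) (auto simp: nbrs_def del_verts_def)
    obtain ms where ms: "legal (V - {v}) (del_verts {v} E) f ms"
      "\<And>u. moves ms {u} \<le> 2 * card (V - {v})"
      "\<And>u. u \<in> V - {v} \<Longrightarrow> run f ms u = (if side u then 1 else 2)"
      using less.hyps[OF _ simple_graph_del_verts[OF G] bp side' proper_del_verts[OF f]] card by auto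
    obtain ms' where ms': "legal V E f ms'" "\<forall>u. moves ms' {u} \<le> 2 * card (V - {v}) + 1"
      "\<forall>u\<in>V. run f ms' u = (if side u then 1 else 2)"
      using extend_over_low_degree_vertex[OF G side v f ms] by blast
    have "\<forall>u. moves ms' {u} \<le> 2 * card V" using ms'(2) card by (metis le_SucI add_Suc_right mult_Suc_right add_2_eq_Suc Suc_eq_plus1)
    then show ?thesis using ms' by blast
  next
    case False
    then have deg: "3 \<le> card (nbrs E v)" if "v \<in> V" for v using that by force
    show ?thesis
    proof (cases "V = {}")
      case True
      then show ?thesis by (intro exI[of _ "[]"]) simp
    next
      case False
      have two: "card e = 2" if "e \<in> E" for e using G that by (auto simp: simple_graph_def)
      have side_edge: "side x \<noteq> side y" if "{x, y} \<in> E" for x y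
        using side[of x y] that by (simp add: nbrs_def)
      have sparse: "card E < 2 * card V"
        by (rule bipartite_blob_sparse[OF less.prems(2) S(1) False two side_edge])
      have "\<exists>ms w a b. legal V E f ms \<and> (\<forall>v. moves ms {v} \<le> 2) \<and> w \<in> V \<and> card (nbrs E w) = 3 \<and>
          a \<in> nbrs E w \<and> b \<in> nbrs E w \<and> a \<noteq> b \<and> run f ms a = run f ms b"
        by (rule exists_mergeable[where side = side, OF G _ sparse _ f]) (fact side, fact deg)
      then obtain ms0 w a b where ms0: "legal V E f ms0" "\<forall>v. moves ms0 {v} \<le> 2"
        and w: "w \<in> V" "card (nbrs E w) = 3" "a \<in> nbrs E w" "b \<in> nbrs E w" "a \<noteq> b"
        and eq: "run f ms0 a = run f ms0 b"
        by (elim exE conjE)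
      define g where "g = run f ms0"
      have g_eq: "g a = g b" using eq by (simp add: g_def)
      have g: "proper V E g" unfolding g_def by (rule legal_run_proper[OF G f ms0(1)])
      have abV: "a \<in> V" "b \<in> V" using w S(3) by blast+
      \<comment> \<open>Both lie opposite to \<open>w\<close>; hence merging them creates no loop
        and respects the sides.\<close>
      have ab_side: "side a = side b" using side[OF w(3)] side[OF w(4)] by auto
      then have ab_E: "{a, b} \<notin> E" using side_edge by blast
      have "a \<noteq> w" "b \<noteq> w" using w S(5) by auto
      let ?V = "V - {b}" and ?E = "absorb a b E"
      have G': "simple_graph ?V ?E" by (rule simple_graph_absorb[OF G w(5) ab_E abV(1)])
      note S' = simple_graphD[OF G']
      have N: "nbrs ?E v = (if v = a then nbrs E a \<union> nbrs E b
          else nbrs E v - {b} \<union> (if b \<in> nbrs E v then {a} else {}))" if "v \<noteq> b" for v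
        by (rule nbrs_absorb[OF ab_E that w(5)])
      have b_out: "v \<noteq> b" if "u \<in> nbrs ?E v" for u v using S'(4)[OF that] by blast
      have side': "side u \<noteq> side v" if "u \<in> nbrs ?E v" for u v
        using that N[OF b_out[OF that]] side[of u v] side[of u b] side[of b v] ab_side
        by (auto split: if_splits)
      have g': "proper ?V ?E g"
        unfolding proper_def
      proof (intro conjI ballI allI)
        show "g v \<in> {1..5}" if "v \<in> ?V" for v using g that by (auto simp: proper_def)
        fix v u assume u: "u \<in> nbrs ?E v"
        have ne: "g u \<noteq> g v" if "u \<in> nbrs E v" for u v using g that by (simp add: proper_def)
        show "g u \<noteq> g v"
          using u N[OF b_out[OF u]] ne[of u v] ne[of u b] ne[of b v] g_eq by (auto split: if_splits)
      qed
      \<comment> \<open>The neighbours \<open>a\<close> and \<open>b\<close> of \<open>w\<close>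
        have become one, which brings \<open>w\<close> within reach of the case of degree 2.\<close>
      have "nbrs ?E w = nbrs E w - {b}" using N[of w] \<open>b \<noteq> w\<close> \<open>a \<noteq> w\<close> w by auto
      then have w_deg: "card (nbrs ?E w) \<le> 2" using w S(7)[of w] by simp
      have wV: "w \<in> ?V" using w(1) \<open>b \<noteq> w\<close> by auto
      \<comment> \<open>The loss of two vertices pays for the moves of \<open>ms0\<close> and for
        settling \<open>w\<close>: with n vertices in \<open>V\<close>, 2 (n - 2) + 1 + 2 < 2
        n.\<close>
      have card: "card V = Suc (Suc (card (?V - {w})))"
        using abV(2) wV S(1) by (metis card_Suc_Diff1 finite_Diff)
      have side'': "side u \<noteq> side v" if "u \<in> nbrs (del_verts {w} ?E) v" for u v
        using that by (intro side') (auto simp: nbrs_def del_verts_def)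
      obtain ms1 where ms1: "legal (?V - {w}) (del_verts {w} ?E) g ms1"
        "\<And>u. moves ms1 {u} \<le> 2 * card (?V - {w})"
        "\<And>u. u \<in> ?V - {w} \<Longrightarrow> run g ms1 u = (if side u then 1 else 2)"
        using less.hyps[OF _ simple_graph_del_verts[OF G'] blob_planar_identify[OF G less.prems(2) w(3,4,5)]
            side'' proper_del_verts[OF g']] card by auto
      obtain ms2 where ms2: "legal ?V ?E g ms2" "\<forall>u. moves ms2 {u} \<le> 2 * card (?V - {w}) + 1"
        "\<forall>u\<in>?V. run g ms2 u = (if side u then 1 else 2)"
        using extend_over_low_degree_vertex[OF G' side' wV w_deg g' ms1] by blast
      obtain ms3 where ms3: "legal V E g ms3"
        "\<And>u. u \<noteq> b \<Longrightarrow> run g ms3 u = run g ms2 u \<and> moves ms3 {u} = moves ms2 {u}"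
        "run g ms3 b = run g ms2 a" "moves ms3 {b} = moves ms2 {a}"
        using lift_moves_over_identification[OF G w(5) ab_E abV g_eq ms2(1)] by blast
      have "legal V E f (ms0 @ ms3)" using ms0(1) ms3(1) by (simp add: g_def)
      moreover have "moves (ms0 @ ms3) {v} \<le> 2 * card V" for v
      proof -
        have "moves ms3 {v} \<le> 2 * card (?V - {w}) + 1"
          using ms3(2)[of v] ms3(4) ms2(2) by (cases "v = b") auto
        moreover have "moves ms0 {v} \<le> 2" using ms0(2) by blast
        ultimately show ?thesis unfolding card by simp
      qed
      moreover have "run f (ms0 @ ms3) v = (if side v then 1 else 2)" if "v \<in> V" for v
        using ms3(2)[of v] ms3(3) ms2(3) that abV(1) w(5) ab_side by (cases "v = b") (auto simp: g_def)
      ultimately show ?thesis by blast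
    qed
  qed
qed

section \<open>From legal sequences to walks in the reconfiguration graph\<close>

lemma proper_colourings_iff:
  "f \<in> proper_colourings V E 5 \<longleftrightarrow> f \<in> extensional V \<and> proper V E f"
proof -
  have "(\<forall>x y. {x, y} \<in> E \<longrightarrow> f x \<noteq> f y) \<longleftrightarrow> (\<forall>v. \<forall>u\<in>nbrs E v. f u \<noteq> f v)"
    by (auto simp: nbrs_def)
  then show ?thesis by (auto simp: proper_colourings_def proper_def PiE_def)
qed

text \<open>The walk can be shorter than \<open>ms\<close>: a move that repeats the present colour
  gives no edge and is skipped.\<close>

lemma legal_imp_walk:
  assumes G: "simple_graph V E"
  shows "f \<in> proper_colourings V E 5 \<Longrightarrow> legal V E f ms \<Longrightarrow>
    run f ms \<in> proper_colourings V E 5 \<and>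
    (\<exists>k\<le>length ms. (f, run f ms) \<in> {(u, v). {u, v} \<in> recolouring_edges V E 5} ^^ k)"
proof (induction ms arbitrary: f)
  case Nil
  then show ?case by (auto intro: exI[of _ 0])
next
  case (Cons m ms)
  let ?R = "{(u, v). {u, v} \<in> recolouring_edges V E 5}"
  obtain v c where m: "m = (v, c)" by fastforce
  have v: "v \<in> V" "c \<in> {1..5}" "\<forall>u\<in>nbrs E v. f u \<noteq> c" and leg: "legal V E (f(v := c)) ms"
    using Cons.prems(2) unfolding m legal.simps by blast+
  have f: "f \<in> extensional V" "proper V E f" using Cons.prems(1) by (auto simp: proper_colourings_iff)
  have g: "f(v := c) \<in> proper_colourings V E 5"
    using proper_update[OF G f(2) v(2,3)] f(1) v(1) by (auto simp: proper_colourings_iff extensional_def)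
  obtain k where k: "k \<le> length ms" "(f(v := c), run (f(v := c)) ms) \<in> ?R ^^ k"
    and run: "run (f(v := c)) ms \<in> proper_colourings V E 5"
    using Cons.IH[OF g leg] by blast
  show ?case
  proof (cases "f v = c")
    case True
    then have "f(v := c) = f" by auto
    then show ?thesis using k run unfolding m by (auto simp del: fun_upd_apply intro: le_SucI)
  next
    case False
    then have "{x \<in> V. f x \<noteq> (f(v := c)) x} = {v}" using v(1) by auto
    then have "card {x \<in> V. f x \<noteq> (f(v := c)) x} = 1" by simp
    then have "(f, f(v := c)) \<in> ?R"
      using Cons.prems(1) g unfolding recolouring_edges_def by blast
    then have "(f, run (f(v := c)) ms) \<in> ?R ^^ Suc k"
      using k(2) by (rule relpow_Suc_I2)
    then show ?thesis using k(1) run unfolding m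
      by (intro conjI exI[of _ "Suc k"]) (simp_all del: relpow.simps fun_upd_apply)
  qed
qed

lemma legal_length: "legal V E f ms \<Longrightarrow> length ms = moves ms V"
proof (induction ms arbitrary: f)
  case (Cons m ms)
  obtain v c where m: "m = (v, c)" by fastforce
  have "v \<in> V" "legal V E (f(v := c)) ms" using Cons.prems by (simp_all add: m del: fun_upd_apply)
  then show ?case using Cons.IH by (simp add: m)
qed simp

lemma relpow_sym_swap:
  assumes "sym R" "(x, y) \<in> R ^^ k"
  shows "(y, x) \<in> R ^^ k"
  using assms(2)
proof (induction k arbitrary: y)
  case (Suc k)
  then obtain z where "(x, z) \<in> R ^^ k" "(z, y) \<in> R" by auto
  then have "(y, z) \<in> R" "(z, x) \<in> R ^^ k" using Suc.IH assms(1) by (auto dest: symD)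
  then show ?case by (rule relpow_Suc_I2)
qed simp

theorem theorem2:
  fixes V :: "'a set" and E :: "'a set set" and n :: nat
  assumes "simple_graph V E" and "card V = n"
    and "planar V E" and "bipartite V E"
  shows "graph_diameter (proper_colourings V E 5) (recolouring_edges V E 5) \<le> enat (4 * n\<^sup>2)"
proof -
  let ?R = "{(u, v). {u, v} \<in> recolouring_edges V E 5}"
  have bp: "blob_planar V E" by (rule planar_imp_blob_planar[OF assms(1,3)])
  obtain A B where "A \<union> B = V \<and> A \<inter> B = {} \<and> (\<forall>e\<in>E. \<exists>a\<in>A. \<exists>b\<in>B. e = {a, b})"
    using assms(4) unfolding bipartite_def by (elim exE)
  then have AB: "A \<inter> B = {}" "\<And>e. e \<in> E \<Longrightarrow> \<exists>a\<in>A. \<exists>b\<in>B. e = {a, b}"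
    by simp_all
  define side where "side v \<longleftrightarrow> v \<in> A" for v
  have side: "side u \<noteq> side v" if uv: "u \<in> nbrs E v" for u v
  proof -
    have "{u, v} \<in> E" using uv by (simp add: nbrs_def)
    from AB(2)[OF this] obtain a b where "a \<in> A" "b \<in> B" "{u, v} = {a, b}" by blast
    then show ?thesis using AB(1) by (auto simp: side_def doubleton_eq_iff)
  qed
  \<comment> \<open>The restriction to \<open>V\<close> makes the target extensional, so that all
    recolourings end at the same function and not merely at functions agreeing on
    \<open>V\<close>.\<close>
  define h where "h = restrict (\<lambda>v. if side v then 1 else 2 :: nat) V"
  have to_h: "\<exists>k\<le>2 * n\<^sup>2. (f, h) \<in> ?R ^^ k" if f: "f \<in> proper_colourings V E 5" for f
  proof -
    have "proper V E f" using f by (simp add: proper_colourings_iff)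
    then obtain ms where ms: "legal V E f ms" "\<forall>v. moves ms {v} \<le> 2 * card V"
      "\<forall>v\<in>V. run f ms v = (if side v then 1 else 2)"
      using recolour_to_side_colouring[where side = side, OF assms(1) bp side] by blast
    obtain k where k: "k \<le> length ms" "(f, run f ms) \<in> ?R ^^ k" "run f ms \<in> proper_colourings V E 5"
      using legal_imp_walk[OF assms(1) f ms(1)] by blast
    have "run f ms = h"
      using k(3) ms(3) by (intro extensionalityI[of _ V]) (auto simp: proper_colourings_iff h_def)
    moreover have "length ms \<le> 2 * n\<^sup>2"
    proof -
      have "length ms = (\<Sum>v\<in>V. moves ms {v})"
        using legal_length[OF ms(1)] moves_eq_sum[OF simple_graphD(1)[OF assms(1)]] by simp
      also have "\<dots> \<le> (\<Sum>v\<in>V. 2 * card V)" using ms(2) by (intro sum_mono) blast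
      finally show ?thesis using assms(2) by (simp add: power2_eq_square)
    qed
    ultimately show ?thesis using k by (intro exI[of _ k]) auto
  qed
  have "sym ?R" by (auto simp: sym_def insert_commute)
  have "graph_dist (recolouring_edges V E 5) x y \<le> enat (4 * n\<^sup>2)"
    if x: "x \<in> proper_colourings V E 5" and y: "y \<in> proper_colourings V E 5" for x y
  proof -
    obtain k l where k: "k \<le> 2 * n\<^sup>2" "(x, h) \<in> ?R ^^ k" and l: "l \<le> 2 * n\<^sup>2" "(y, h) \<in> ?R ^^ l"
      using to_h[OF x] to_h[OF y] by blast
    have "(x, y) \<in> ?R ^^ (k + l)"
      unfolding relpow_add using k(2) relpow_sym_swap[OF \<open>sym ?R\<close> l(2)] by (rule relcompI)
    then have "graph_dist (recolouring_edges V E 5) x y \<le> enat (k + l)"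
      unfolding graph_dist_def by (intro INF_lower) simp
    also have "\<dots> \<le> enat (4 * n\<^sup>2)" using k(1) l(1) by simp
    finally show ?thesis .
  qed
  then show ?thesis unfolding graph_diameter_def by (intro SUP_least) auto
qed

end
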